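(* Let $\Sigma$ be a finite alphabet of size $\sigma\ge2$ (not necessarily constant). For any constant $0<\epsilon<1$ there exists an algorithm which, given an arbitrary pattern $x$ of length $m$ over $\Sigma\cup\{\phi\}$ with $g<m$ wildcards $\phi$ and a text $t$ of length $n>m$ drawn uniformly at random over $\Sigma$, finds all $i$ such that $t[i..i+m-1]$ matches $x$, with average-case search time $$O\!\left(\frac{n\log_\sigma m\,\log_2 m}{m}\right)$$ whenever $$g+\frac{\log_2 m}{\mathcal{F}^0(x)}+\frac{\log_2 m}{\mathcal{F}^1(x)}+\dots+\frac{\log_2 m}{\mathcal{F}^{3\log_2 m}(x)}<\epsilon m .$$
   Context: The wildcard $\phi\notin\Sigma$ matches itself and every letter of $\Sigma$: two characters $a,b\in\Sigma\cup\{\phi\}$ correspond, $a\approx^{\phi} b$, if they are equal or at least one of them is $\phi$; two strings of equal length match if they correspond at every position. Strings are indexed from $0$. Problem (Wildcards in the Pattern): given a text $t$ of length $n$ over $\Sigma$ and a pattern $x$ of length $m$ over $\Sigma\cup\{\phi\}$, find all $i$ with $t[i..i+m-1]\approx^{\phi} x[0..m-1]$. Model: word RAM with word size $\Omega(\log n)$. The pattern is arbitrary (not random). The characters of the text are independent and uniform over $\Sigma$. The average-case search time is the expected running time over the random text, for an arbitrary (worst-case) pattern satisfying the hypothesis, not counting the time spent preprocessing the pattern. The asymptotic bound is for sufficiently large $m$. For a pattern $x$ of length $m$ with $g$ wildcards, define $$\mathcal{F}^0(x)=\log_2\frac{2m}{m+g},\qquad \mathcal{F}^i(x)=\log_2\frac{2m}{m+g+\frac{\log_2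 m}{\mathcal{F}^0(x)}+\frac{\log_2 m}{\mathcal{F}^1(x)}+\dots+\frac{\log_2 m}{\mathcal{F}^{i-1}(x)}}\quad(i\ge1),$$ where all the values $\mathcal{F}^j(x)$ occurring in the hypothesis are understood to be well defined and positive. The index $3\log_2 m$ is understood as rounded up to an integer.
   Formalization: The factor log_σ m in the time bound is replaced by max(1, log_σ m); for alphabets superpolynomially larger than m the stated bound is false, e.g. for σ = 2^m at least about n/m characters must be inspected. For σ ≤ m the bound is unchanged. *)

theory Defs
  imports "HOL-Probability.Probability"
begin

section \<open>Matching with wildcards\<close>

text \<open>
  The alphabet of size \<open>\<sigma>\<close> is \<open>{..<\<sigma>}\<close>. In a string over the alphabet extended by the wildcard,
  \<^const>\<open>None\<close> is the wildcard and \<^term>\<open>Some a\<close> is the letter \<open>a\<close>.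
\<close>

definition is_text :: "nat \<Rightarrow> nat list \<Rightarrow> bool" where
  "is_text \<sigma> t \<longleftrightarrow> set t \<subseteq> {..<\<sigma>}"

definition is_pattern :: "nat \<Rightarrow> nat option list \<Rightarrow> bool" where
  "is_pattern \<sigma> x \<longleftrightarrow> (\<forall>a. Some a \<in> set x \<longrightarrow> a < \<sigma>)"

definition corresponds :: "nat option \<Rightarrow> nat option \<Rightarrow> bool" where
  "corresponds a b \<longleftrightarrow> a = b \<or> a = None \<or> b = None"

definition matches :: "nat option list \<Rightarrow> nat option list \<Rightarrow> bool" where
  "matches u v \<longleftrightarrow> list_all2 corresponds u v"

definition occurrences :: "nat option list \<Rightarrow> nat list \<Rightarrow> nat set" where
  "occurrences x t =
     {i. i + length x \<le> length t \<and> matches (map Some (take (length x) (drop i t))) x}"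

definition wildcards :: "nat option list \<Rightarrow> nat" where
  "wildcards x = count_list x None"

text \<open>For \<open>i = 0\<close> the inner sum is empty, which gives the base case of the recursion.\<close>

context
  notes sum.cong [fundef_cong]
begin

function F :: "nat option list \<Rightarrow> nat \<Rightarrow> real" where
  "F x i = log 2 (2 * real (length x) /
     (real (length x) + real (wildcards x) + (\<Sum>j<i. log 2 (real (length x)) / F x j)))"
  by pat_completeness auto
termination
  by (relation "Wellfounded.measure snd") auto

end

declare F.simps [simp del]


section \<open>A word RAM\<close>

text \<open>
  Programs are structured, and every operator of an expression and every command costs one time
  unit, so that a program is a finite sequence of unit-cost word operations up to constant factors.
  All values, and hence all memory addresses, are reduced modulo \<open>2 ^ w\<close>, where \<open>w\<close> is the word size.
  The pattern and the text are read-only random access inputs; memory is initially zero.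
\<close>

datatype binop = Add | Sub | Mul | Div | Mod | And | Or | Xor | Shl | Shr | Less | Eq

datatype expr =
    Const nat
  | Reg nat
  | Load expr
  | PatChar expr
  | TextChar expr
  | PatLen
  | TextLen
  | AlphSize
  | Bin binop expr expr

datatype com =
    Skip
  | Assign nat expr
  | Store expr expr
  | Emit expr
  | Seq com com
  | If expr com com
  | While expr com

record inputs =
  wordsize :: nat
  alph :: nat
  pat :: "nat option list"
  input_text :: "nat list"

record state =
  regs :: "nat \<Rightarrow> nat"
  mem :: "nat \<Rightarrow> nat"
  out :: "nat list"

definition init_state :: state where
  "init_state = \<lparr>regs = (\<lambda>_. 0), mem = (\<lambda>_. 0), out = []\<rparr>"

text \<open>\<^const>\<open>Sub\<close> wraps around; its right operand is always below \<open>2 ^ w\<close>.\<close>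

fun binop_val :: "nat \<Rightarrow> binop \<Rightarrow> nat \<Rightarrow> nat \<Rightarrow> nat" where
  "binop_val w Add a b = a + b"
| "binop_val w Sub a b = a + 2 ^ w - b"
| "binop_val w Mul a b = a * b"
| "binop_val w Div a b = a div b"
| "binop_val w Mod a b = a mod b"
| "binop_val w And a b = Bit_Operations.and a b"
| "binop_val w Or a b = Bit_Operations.or a b"
| "binop_val w Xor a b = Bit_Operations.xor a b"
| "binop_val w Shl a b = push_bit b a"
| "binop_val w Shr a b = drop_bit b a"
| "binop_val w Less a b = (if a < b then 1 else 0)"
| "binop_val w Eq a b = (if a = b then 1 else 0)"

text \<open>
  A wildcard of the pattern is presented to the program as the number \<open>\<sigma>\<close>, which is not a letter.
  Reading an input outside its bounds yields 0.
\<close>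

definition pat_char :: "inputs \<Rightarrow> nat \<Rightarrow> nat" where
  "pat_char I i =
     (if i < length (pat I) then (case pat I ! i of None \<Rightarrow> alph I | Some a \<Rightarrow> a) else 0)"

definition text_char :: "inputs \<Rightarrow> nat \<Rightarrow> nat" where
  "text_char I i = (if i < length (input_text I) then input_text I ! i else 0)"

primrec expr_val :: "inputs \<Rightarrow> state \<Rightarrow> expr \<Rightarrow> nat" where
  "expr_val I s (Const k) = k mod 2 ^ wordsize I"
| "expr_val I s (Reg r) = regs s r mod 2 ^ wordsize I"
| "expr_val I s (Load e) = mem s (expr_val I s e) mod 2 ^ wordsize I"
| "expr_val I s (PatChar e) = pat_char I (expr_val I s e) mod 2 ^ wordsize I"
| "expr_val I s (TextChar e) = text_char I (expr_val I s e) mod 2 ^ wordsize I"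
| "expr_val I s PatLen = length (pat I) mod 2 ^ wordsize I"
| "expr_val I s TextLen = length (input_text I) mod 2 ^ wordsize I"
| "expr_val I s AlphSize = alph I mod 2 ^ wordsize I"
| "expr_val I s (Bin f e1 e2) =
     binop_val (wordsize I) f (expr_val I s e1) (expr_val I s e2) mod 2 ^ wordsize I"

primrec expr_cost :: "expr \<Rightarrow> nat" where
  "expr_cost (Const k) = 1"
| "expr_cost (Reg r) = 1"
| "expr_cost (Load e) = Suc (expr_cost e)"
| "expr_cost (PatChar e) = Suc (expr_cost e)"
| "expr_cost (TextChar e) = Suc (expr_cost e)"
| "expr_cost PatLen = 1"
| "expr_cost TextLen = 1"
| "expr_cost AlphSize = 1"
| "expr_cost (Bin f e1 e2) = Suc (expr_cost e1 + expr_cost e2)"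

text \<open>\<open>exec I c s k s'\<close>: on inputs \<open>I\<close>, program \<open>c\<close> started in \<open>s\<close> halts in \<open>s'\<close> after \<open>k\<close> time units.\<close>

inductive exec :: "inputs \<Rightarrow> com \<Rightarrow> state \<Rightarrow> nat \<Rightarrow> state \<Rightarrow> bool" for I :: inputs where
  Skip: "exec I Skip s 1 s"
| Assign: "exec I (Assign r e) s (Suc (expr_cost e)) (s\<lparr>regs := (regs s)(r := expr_val I s e)\<rparr>)"
| Store: "exec I (Store a e) s (Suc (expr_cost a + expr_cost e))
            (s\<lparr>mem := (mem s)(expr_val I s a := expr_val I s e)\<rparr>)"
| Emit: "exec I (Emit e) s (Suc (expr_cost e)) (s\<lparr>out := out s @ [expr_val I s e]\<rparr>)"
| Seq: "\<lbrakk>exec I c1 s k1 s1; exec I c2 s1 k2 s2\<rbrakk> \<Longrightarrow> exec I (Seq c1 c2) s (Suc (k1 + k2)) s2"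
| IfTrue: "\<lbrakk>expr_val I s b \<noteq> 0; exec I c1 s k s'\<rbrakk>
    \<Longrightarrow> exec I (If b c1 c2) s (Suc (expr_cost b + k)) s'"
| IfFalse: "\<lbrakk>expr_val I s b = 0; exec I c2 s k s'\<rbrakk>
    \<Longrightarrow> exec I (If b c1 c2) s (Suc (expr_cost b + k)) s'"
| WhileFalse: "expr_val I s b = 0 \<Longrightarrow> exec I (While b c) s (Suc (expr_cost b)) s"
| WhileTrue: "\<lbrakk>expr_val I s b \<noteq> 0; exec I c s k1 s1; exec I (While b c) s1 k2 s2\<rbrakk>
    \<Longrightarrow> exec I (While b c) s (Suc (expr_cost b + k1 + k2)) s2"

text \<open>Execution is deterministic, so the final state and the running time are well defined.\<close>

lemma exec_deterministic:
  "exec I c s k s' \<Longrightarrow> exec I c s k' s'' \<Longrightarrow> k' = k \<and> s'' = s'"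
proof (induction arbitrary: k' s'' rule: exec.induct)
  case (Seq c1 s k1 s1 c2 k2 s2)
  from Seq.prems show ?case by (cases rule: exec.cases) (use Seq.IH in blast)
next
  case (IfTrue s b c1 k s' c2)
  from IfTrue.prems show ?case by (cases rule: exec.cases) (use IfTrue.hyps IfTrue.IH in blast)+
next
  case (IfFalse s b c2 k s' c1)
  from IfFalse.prems show ?case by (cases rule: exec.cases) (use IfFalse.hyps IfFalse.IH in blast)+
next
  case (WhileTrue s b c k1 s1 k2 s2)
  from WhileTrue.prems show ?case
    by (cases rule: exec.cases) (use WhileTrue.hyps WhileTrue.IH in blast)+
next
  case (WhileFalse s b c)
  from WhileFalse.prems show ?case by (cases rule: exec.cases) (use WhileFalse.hyps in blast)+
qed (erule exec.cases; simp; fail)+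


section \<open>Pattern matching algorithms\<close>

text \<open>
  An algorithm consists of a preprocessing program, which is run on the pattern alone (with an empty
  text) and whose time is not counted, and of a search program, which starts in the state left
  behind by the preprocessing and also has access to the text. \<open>T t\<close> is the search time on \<open>t\<close>.
\<close>

definition finds_occurrences ::
  "com \<Rightarrow> com \<Rightarrow> nat \<Rightarrow> nat \<Rightarrow> nat option list \<Rightarrow> nat \<Rightarrow> (nat list \<Rightarrow> nat) \<Rightarrow> bool" where
  "finds_occurrences prep srch w \<sigma> x n T \<longleftrightarrow>
     (\<exists>k s0. exec \<lparr>wordsize = w, alph = \<sigma>, pat = x, input_text = []\<rparr> prep init_state k s0 \<and>
       (\<forall>t. is_text \<sigma> t \<and> length t = n \<longrightarrow>
         (\<exists>s1. exec \<lparr>wordsize = w, alph = \<sigma>, pat = x, input_text = t\<rparr> srch (s0\<lparr>out := []\<rparr>) (T t) s1 \<and>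
               set (out s1) = occurrences x t)))"

definition random_text :: "nat \<Rightarrow> nat \<Rightarrow> nat list pmf" where
  "random_text \<sigma> n = replicate_pmf n (pmf_of_set {..<\<sigma>})"

text \<open>
  For \<open>\<sigma> > m\<close> the factor \<open>log\<^sub>\<sigma> m\<close> of the time bound is read as 1: no algorithm can use fewer than
  about \<open>n / m\<close> steps, whereas \<open>log\<^sub>\<sigma> m\<close> tends to 0 as \<open>\<sigma>\<close> grows. For \<open>\<sigma> \<le> m\<close> nothing changes:
\<close>

definition log_factor :: "nat \<Rightarrow> nat \<Rightarrow> real" where
  "log_factor \<sigma> m = max 1 (log (real \<sigma>) (real m))"

lemma log_factor_eq: "2 \<le> \<sigma> \<Longrightarrow> \<sigma> \<le> m \<Longrightarrow> log_factor \<sigma> m = log (real \<sigma>) (real m)"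
  by (simp add: log_factor_def max_def)

end

theory Submission
  imports Defs "HOL-Real_Asymp.Real_Asymp"
begin

text \<open>
  The text is processed in \<open>n div m\<close> windows of \<open>m\<close> consecutive alignments. With \<open>s = min \<sigma> m\<close> and
  \<open>q\<close> minimal such that \<open>s ^ q \<ge> m\<close>, the positions covered by a window are cut into blocks of \<open>Q = O(q)\<close> positions. An alignment is good at a block if at
  least \<open>h = 8 q\<close> of its non-wildcard positions fall into the block. Since the pattern has a constant
  fraction of non-wildcards, every alignment is good at a constant fraction of the blocks, so that a
  greedy choice of \<open>O(log m)\<close> blocks yields for every alignment a block at which it is good. The letters
  of one block, reduced modulo \<open>s\<close>, form a number below \<open>s ^ Q\<close>, which is polynomial in \<open>m\<close>; hence the
  preprocessing can tabulate, for every block and every possible content, the least good alignment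
  consistent with it. The search reads the chosen blocks of a window, which takes time
  \<open>O(q log m)\<close>, and checks the window naively if some table lookup returns an alignment. A residue
  modulo \<open>s\<close> has probability at most \<open>s powr (- 1/2)\<close>, so an alignment survives a block at which it is good
  with probability at most \<open>m ^ -4\<close>, and the naive checks take expected time \<open>O(1)\<close> per window.
\<close>

section \<open>Total correctness and running time of programs\<close>

text \<open>Three demands shape the construction. The word size is only guaranteed to be a constant
  multiple of \<open>log 2 n\<close>, while \<sigma> may be far larger than \<open>m\<close>;
  reducing letters modulo \<open>s = min \<sigma> m\<close> keeps \<open>s ^ q\<close> between
  \<open>m\<close> and \<open>m ^ 2\<close>, so that the tables stay polynomial in \<open>m\<close>.
  Wildcards are placed adversarially, so that no single block need be good for all alignments; each
  block of the greedy cover serves a constant fraction of the alignments still uncovered, and the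
  number of rounds is the source of the factor \<open>log 2 m\<close>, while the block length gives
  \<open>log_factor \<sigma> m\<close>. Finally the output must be correct for every pattern, also
  for one with too many wildcards: the number of alignments left uncovered is handed to the search,
  which checks every window naively if it is nonzero. The exponent 4 is the price of a union bound:
  at most \<open>m\<close> blocks and \<open>m\<close> alignments leave probability at most
  \<open>1 / m ^ 2\<close> per window, which pays for a naive check of \<open>O(m ^ 2)\<close>
  steps. Neighbouring windows share text, but only linearity of expectation is used.\<close>

definition wp :: "inputs \<Rightarrow> com \<Rightarrow> (nat \<Rightarrow> state \<Rightarrow> bool) \<Rightarrow> state \<Rightarrow> bool" where
  "wp I c Q s \<longleftrightarrow> (\<exists>k s'. exec I c s k s' \<and> Q k s')"

text \<open>Execution is deterministic, so the rules for loop-free commands are equivalences and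
  evaluate such programs by rewriting. The cost is threaded through the postcondition.\<close>

lemma wp_Skip: "wp I Skip Q s \<longleftrightarrow> Q 1 s"
  unfolding wp_def by (metis exec.Skip exec_deterministic)

lemma wp_Assign:
  "wp I (Assign r e) Q s \<longleftrightarrow> Q (Suc (expr_cost e)) (s\<lparr>regs := (regs s)(r := expr_val I s e)\<rparr>)"
  unfolding wp_def by (metis exec.Assign exec_deterministic)

lemma wp_Store:
  "wp I (Store a e) Q s \<longleftrightarrow> Q (Suc (expr_cost a + expr_cost e))
     (s\<lparr>mem := (mem s)(expr_val I s a := expr_val I s e)\<rparr>)"
  unfolding wp_def by (metis exec.Store exec_deterministic)

lemma wp_Emit:
  "wp I (Emit e) Q s \<longleftrightarrow> Q (Suc (expr_cost e)) (s\<lparr>out := out s @ [expr_val I s e]\<rparr>)"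
  unfolding wp_def by (metis exec.Emit exec_deterministic)

lemma wp_Seq:
  "wp I (Seq c1 c2) Q s \<longleftrightarrow> wp I c1 (\<lambda>k1. wp I c2 (\<lambda>k2. Q (Suc (k1 + k2)))) s"
proof
  assume "wp I (Seq c1 c2) Q s"
  then obtain k s' where e: "exec I (Seq c1 c2) s k s'" "Q k s'"
    by (auto simp: wp_def)
  from e(1) show "wp I c1 (\<lambda>k1. wp I c2 (\<lambda>k2. Q (Suc (k1 + k2)))) s"
    by (cases rule: exec.cases) (use e(2) in \<open>auto simp: wp_def\<close>)
qed (fastforce simp: wp_def intro: exec.Seq)

lemma wp_If:
  "wp I (If b c1 c2) Q s \<longleftrightarrow>
     (if expr_val I s b \<noteq> 0 then wp I c1 (\<lambda>k. Q (Suc (expr_cost b + k))) s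
      else wp I c2 (\<lambda>k. Q (Suc (expr_cost b + k))) s)"
proof
  assume "wp I (If b c1 c2) Q s"
  then obtain k s' where e: "exec I (If b c1 c2) s k s'" "Q k s'"
    by (auto simp: wp_def)
  from e(1) show "if expr_val I s b \<noteq> 0 then wp I c1 (\<lambda>k. Q (Suc (expr_cost b + k))) s
      else wp I c2 (\<lambda>k. Q (Suc (expr_cost b + k))) s"
    by (cases rule: exec.cases) (use e(2) in \<open>auto simp: wp_def\<close>)
qed (auto simp: wp_def split: if_splits intro: exec.intros)

lemmas wp_simps = wp_Skip wp_Assign wp_Store wp_Emit wp_Seq wp_If

text \<open>As a congruence rule it lets the simplifier normalise the state only, leaving the
  program and the postcondition untouched.\<close>

lemma wp_weak_cong: "s = s' \<Longrightarrow> wp I c Q s = wp I c Q s'"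
  by simp

lemma wp_mono: "wp I c Q s \<Longrightarrow> (\<And>k s'. Q k s' \<Longrightarrow> Q' k s') \<Longrightarrow> wp I c Q' s"
  by (auto simp: wp_def)

lemma expr_val_less: "expr_val I s e < 2 ^ wordsize I"
  by (cases e) auto

text \<open>Exact arithmetic under the condition that the result fits into a word. With these
  equations in place of the defining ones, absence of overflow becomes a side condition for the
  simplifier, and reduction modulo \<open>2 ^ w\<close> disappears.\<close>

lemma expr_val_bounded:
  "k < 2 ^ wordsize I \<Longrightarrow> expr_val I s (Const k) = k"
  "regs s r < 2 ^ wordsize I \<Longrightarrow> expr_val I s (Reg r) = regs s r"
  "mem s (expr_val I s e) < 2 ^ wordsize I \<Longrightarrow> expr_val I s (Load e) = mem s (expr_val I s e)"
  "pat_char I (expr_val I s e) < 2 ^ wordsize I \<Longrightarrow> expr_val I s (PatChar e) = pat_char I (expr_val I s e)"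
  "text_char I (expr_val I s e) < 2 ^ wordsize I \<Longrightarrow> expr_val I s (TextChar e) = text_char I (expr_val I s e)"
  "length (pat I) < 2 ^ wordsize I \<Longrightarrow> expr_val I s PatLen = length (pat I)"
  "length (input_text I) < 2 ^ wordsize I \<Longrightarrow> expr_val I s TextLen = length (input_text I)"
  "alph I < 2 ^ wordsize I \<Longrightarrow> expr_val I s AlphSize = alph I"
  "expr_val I s a + expr_val I s b < 2 ^ wordsize I \<Longrightarrow>
     expr_val I s (Bin Add a b) = expr_val I s a + expr_val I s b"
  "expr_val I s b \<le> expr_val I s a \<Longrightarrow>
     expr_val I s (Bin Sub a b) = expr_val I s a - expr_val I s b"
  "expr_val I s a * expr_val I s b < 2 ^ wordsize I \<Longrightarrow>
     expr_val I s (Bin Mul a b) = expr_val I s a * expr_val I s b"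
  "expr_val I s (Bin Div a b) = expr_val I s a div expr_val I s b"
  "expr_val I s (Bin Mod a b) = expr_val I s a mod expr_val I s b"
  "0 < wordsize I \<Longrightarrow> expr_val I s (Bin Less a b) = (if expr_val I s a < expr_val I s b then 1 else 0)"
  "0 < wordsize I \<Longrightarrow> expr_val I s (Bin Eq a b) = (if expr_val I s a = expr_val I s b then 1 else 0)"
proof -
  have less: "expr_val I s a < 2 ^ wordsize I" for a by (rule expr_val_less)
  show "expr_val I s (Bin Div a b) = expr_val I s a div expr_val I s b"
    using less[of a] le_less_trans[OF div_le_dividend less] by simp
  show "expr_val I s (Bin Mod a b) = expr_val I s a mod expr_val I s b"
    using less[of a] le_less_trans[OF mod_less_eq_dividend less] by simp
  show "expr_val I s (Bin Sub a b) = expr_val I s a - expr_val I s b"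
    if "expr_val I s b \<le> expr_val I s a"
    using less[of a] that by (simp add: mod_if)
qed (auto simp: less_Suc_eq)

lemma expr_val_const:
  "expr_val I s (Const 0) = 0"
  "0 < wordsize I \<Longrightarrow> expr_val I s (Const (Suc 0)) = Suc 0"
  by auto

lemmas expr_val_rules = expr_val_bounded expr_val_const

definition For :: "nat \<Rightarrow> expr \<Rightarrow> com \<Rightarrow> com" where
  "For r e c = Seq (Assign r (Const 0))
     (While (Bin Less (Reg r) e) (Seq c (Assign r (Bin Add (Reg r) (Const 1)))))"

abbreviation set_reg :: "nat \<Rightarrow> nat \<Rightarrow> state \<Rightarrow> state" where
  "set_reg r v s \<equiv> s\<lparr>regs := (regs s)(r := v)\<rparr>"

text \<open>The bound \<open>e\<close> is evaluated again before every round, hence the premise that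
  the invariant fixes its value. Besides the body and \<open>e\<close>, a round costs 8 units: 2 for
  the comparison, 4 for the increment, 1 each for \<open>Seq\<close> and \<open>While\<close>.
  Initialisation and the last, failing test account for the 6.\<close>

lemma wp_For:
  assumes N: "N < 2 ^ wordsize I"
    and init: "Inv 0 0 (set_reg r 0 s)"
    and bound: "\<And>i k s. i \<le> N \<Longrightarrow> Inv i k s \<Longrightarrow> regs s r = i \<Longrightarrow> expr_val I s e = N"
    and step: "\<And>i k s. i < N \<Longrightarrow> Inv i k s \<Longrightarrow> regs s r = i \<Longrightarrow>
      wp I c (\<lambda>k' s'. regs s' r = i \<and> Inv (Suc i) (k + k' + expr_cost e + 8) (set_reg r (Suc i) s')) s"
    and fin: "\<And>k s. Inv N k s \<Longrightarrow> regs s r = N \<Longrightarrow> Q (k + expr_cost e + 6) s"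
  shows "wp I (For r e c) Q s"
proof -
  let ?M = "2 ^ wordsize I :: nat"
  let ?b = "Bin Less (Reg r) e"
  let ?body = "Seq c (Assign r (Bin Add (Reg r) (Const 1)))"
  \<comment> \<open>The 3 stands for the initial assignment and the enclosing \<open>Seq\<close>,
    which lie outside the loop.\<close>
  have loop: "\<exists>k' s'. exec I (While ?b ?body) s k' s' \<and> Q (k + k' + 3) s'"
    if "Inv i k s" "regs s r = i" "i \<le> N" for i k s
    using that
  proof (induction "N - i" arbitrary: i k s)
    case 0
    then have "i = N" by simp
    then have "expr_val I s ?b = 0"
      using bound[of i k s] 0 N by simp
    then have "exec I (While ?b ?body) s (Suc (expr_cost ?b)) s"
      by (rule exec.WhileFalse)
    moreover have "Q (k + Suc (expr_cost ?b) + 3) s"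
      using fin[of k s] 0 \<open>i = N\<close> by (simp add: eval_nat_numeral)
    ultimately show ?case by blast
  next
    case (Suc d)
    then have iN: "i < N" by simp
    then have M: "1 < ?M" "i < ?M" "Suc i < ?M" using N by auto
    then have W: "0 < wordsize I" by (cases "wordsize I") auto
    have b: "expr_val I s ?b \<noteq> 0"
      using bound[of i k s] Suc.prems iN M N W by simp
    from step[OF iN Suc.prems(1,2)] obtain k1 s1 where
      1: "exec I c s k1 s1" "regs s1 r = i"
         "Inv (Suc i) (k + k1 + expr_cost e + 8) (set_reg r (Suc i) s1)"
      by (auto simp: wp_def)
    have "expr_val I s1 (Bin Add (Reg r) (Const 1)) = Suc i"
      using 1(2) M W by simp
    then have a: "exec I (Assign r (Bin Add (Reg r) (Const 1))) s1 4 (set_reg r (Suc i) s1)"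
      using exec.Assign[of I r "Bin Add (Reg r) (Const 1)" s1]
      by (simp add: eval_nat_numeral)
    have d: "d = N - Suc i" using Suc.hyps(2) by simp
    obtain k2 s2 where
      2: "exec I (While ?b ?body) (set_reg r (Suc i) s1) k2 s2"
         "Q (k + k1 + expr_cost e + 8 + k2 + 3) s2"
      using Suc.hyps(1)[OF d 1(3)] iN by auto
    have "exec I (While ?b ?body) s (Suc (expr_cost ?b + Suc (k1 + 4) + k2)) s2"
      by (rule exec.WhileTrue[OF b exec.Seq[OF 1(1) a] 2(1)])
    moreover have "Q (k + Suc (expr_cost ?b + Suc (k1 + 4) + k2) + 3) s2"
      using 2(2) by (simp add: algebra_simps eval_nat_numeral)
    ultimately show ?case by blast
  qed
  have as: "exec I (Assign r (Const 0)) s 2 (set_reg r 0 s)"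
    using exec.Assign[of I r "Const 0" s] by (simp add: eval_nat_numeral)
  obtain k' s' where "exec I (While ?b ?body) (set_reg r 0 s) k' s'" "Q (0 + k' + 3) s'"
    using loop[OF init] by auto
  then show ?thesis
    unfolding wp_def For_def using exec.Seq[OF as] by (fastforce simp: eval_nat_numeral)
qed

declare expr_val.simps [simp del] expr_val_rules [simp] wp_weak_cong [cong]

definition same_except :: "nat set \<Rightarrow> state \<Rightarrow> state \<Rightarrow> bool" where
  "same_except A s s' \<longleftrightarrow> (\<forall>r. r \<notin> A \<longrightarrow> regs s' r = regs s r) \<and> mem s' = mem s \<and> out s' = out s"

lemma same_regs: "same_except A t t' \<Longrightarrow> r \<notin> A \<Longrightarrow> regs t' r = regs t r"
  and same_mem: "same_except A t t' \<Longrightarrow> mem t' = mem t"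
  by (auto simp: same_except_def)

lemma same_trans: "same_except A t t' \<Longrightarrow> same_except A' t' t'' \<Longrightarrow> A \<union> A' \<subseteq> A'' \<Longrightarrow> same_except A'' t t''"
  unfolding same_except_def by (metis UnI1 UnI2 subsetD)

section \<open>Blocks and alignments\<close>

lemma code_less: "(\<And>j. j < n \<Longrightarrow> d j < s) \<Longrightarrow> (\<Sum>j<n. d j * s ^ j) < (s::nat) ^ n"
proof (induction n)
  case (Suc n)
  then have "(\<Sum>j<n. d j * s ^ j) < s ^ n" by simp
  moreover have "(d n + 1) * s ^ n \<le> s * s ^ n"
    using Suc.prems[of n] by (intro mult_right_mono) auto
  ultimately show ?case by simp
qed auto

lemma code_digit:
  fixes s :: nat
  assumes "\<And>j. j < n \<Longrightarrow> d j < s" "k < n"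
  shows "(\<Sum>j<n. d j * s ^ j) div s ^ k mod s = d k"
  using assms
proof (induction k arbitrary: n d)
  case 0
  then obtain n' where n: "n = Suc n'" by (cases n) auto
  have "(\<Sum>j<n. d j * s ^ j) = d 0 + s * (\<Sum>j<n'. d (Suc j) * s ^ j)"
    unfolding n by (simp add: sum.lessThan_Suc_shift sum_distrib_left algebra_simps del: sum.lessThan_Suc)
  then show ?case using 0 by simp
next
  case (Suc k)
  then obtain n' where n: "n = Suc n'" by (cases n) auto
  have "(\<Sum>j<n. d j * s ^ j) = d 0 + s * (\<Sum>j<n'. d (Suc j) * s ^ j)"
    unfolding n by (simp add: sum.lessThan_Suc_shift sum_distrib_left algebra_simps del: sum.lessThan_Suc)
  then have "(\<Sum>j<n. d j * s ^ j) div s ^ Suc k = (\<Sum>j<n'. d (Suc j) * s ^ j) div s ^ k"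
    using Suc.prems(1)[of 0] n by (simp add: div_mult2_eq)
  then show ?case using Suc.IH[of n' "\<lambda>j. d (Suc j)"] Suc.prems n by simp
qed

text \<open>Nothing is assumed about the number of wildcards, because correctness is claimed for
  every pattern. \<open>R\<close> is a constant built into the program; the time bound later relates
  it to the density of non-wildcards.\<close>

locale probing =
  fixes x :: "nat option list" and \<sigma> R :: nat
  assumes sigma: "2 \<le> \<sigma>" and pattern: "is_pattern \<sigma> x" and nonempty: "0 < length x"
begin

abbreviation m :: nat where "m \<equiv> length x"
definition s :: nat where "s = min \<sigma> m"
definition q :: nat where "q = (LEAST k. m \<le> s ^ k)"
definition h :: nat where "h = 8 * q"
definition Q :: nat where "Q = R * h"
definition S :: nat where "S = s ^ Q"
text \<open>Alignments below \<open>m\<close> reach positions below \<open>2 * m\<close>; the extra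
  block takes the remainder and keeps \<open>B\<close> positive even for \<open>Q = 0\<close>, which
  occurs for \<open>m = 1\<close>.\<close>

definition B :: nat where "B = 2 * m div Q + 1"

text \<open>
  Positions are relative to the start of the window: alignment \<open>i\<close> puts character \<open>y\<close> of the pattern on
  position \<open>i + y\<close>, and block \<open>b\<close> consists of the positions \<open>b Q + k\<close> with \<open>k < Q\<close>.
\<close>

definition hits :: "nat \<Rightarrow> nat \<Rightarrow> nat set" where
  "hits b i = {k. k < Q \<and> i \<le> b * Q + k \<and> b * Q + k < i + m \<and> x ! (b * Q + k - i) \<noteq> None}"

definition good :: "nat \<Rightarrow> nat \<Rightarrow> bool" where
  "good b i \<longleftrightarrow> h \<le> card (hits b i)"

definition consistent :: "nat \<Rightarrow> nat \<Rightarrow> nat \<Rightarrow> bool" where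
  "consistent b i c \<longleftrightarrow>
     (\<forall>k\<in>hits b i. the (x ! (b * Q + k - i)) mod s = c div s ^ k mod s)"

definition covered :: "nat list \<Rightarrow> nat set" where
  "covered bs = {i. i < m \<and> (\<exists>b\<in>set bs. good b i)}"

definition gain :: "nat set \<Rightarrow> nat \<Rightarrow> nat" where
  "gain C b = card {i. i < m \<and> i \<notin> C \<and> good b i}"

text \<open>Tie-breaking is left open, so that any run of the program fits the description. Blocks
  are appended only while uncovered alignments remain, which is what allows the length to be
  bounded.\<close>

inductive greedy_seq :: "nat list \<Rightarrow> bool" where
  Nil: "greedy_seq []"
| snoc: "\<lbrakk>greedy_seq bs; covered bs \<noteq> {..<m}; b < B; \<And>b'. b' < B \<Longrightarrow> gain (covered bs) b' \<le> gain (covered bs) b\<rbrakk>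
    \<Longrightarrow> greedy_seq (bs @ [b])"

text \<open>A table entry \<open>e > 0\<close> stands for alignment \<open>e - 1\<close>, and 0 for no alignment.\<close>

definition entry :: "nat \<Rightarrow> nat \<Rightarrow> nat \<Rightarrow> nat \<Rightarrow> bool" where
  "entry n b c e \<longleftrightarrow> (if e = 0 then \<forall>i<n. \<not> (good b i \<and> consistent b i c)
     else e \<le> n \<and> good b (e - 1) \<and> consistent b (e - 1) c \<and>
       (\<forall>i<e - 1. \<not> (good b i \<and> consistent b i c)))"

lemma greedy_seq_less_B: "greedy_seq bs \<Longrightarrow> set bs \<subseteq> {..<B}"
  by (induction rule: greedy_seq.induct) auto

lemma covered_snoc: "covered (bs @ [b]) = covered bs \<union> {i. i < m \<and> good b i}"
  by (auto simp: covered_def)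

lemma covered_subset: "covered bs \<subseteq> {..<m}"
  by (auto simp: covered_def)

section \<open>Size of the base, of the exponent and of the table\<close>

lemma s_pos: "0 < s" and s_le: "s \<le> m" "s \<le> \<sigma>"
  using sigma nonempty by (auto simp: s_def)

text \<open>Makes the minimum in \<open>q\<close> exist and bounds the loop that computes it. For
  \<open>m = 1\<close> the base is 1, so the comparison with powers of 2 works only for larger
  \<open>m\<close>.\<close>

lemma m_le_s_pow_m: "m \<le> s ^ m"
proof (cases "m = 1")
  case False
  then have "2 \<le> s" using sigma nonempty by (cases "length x") (auto simp: s_def)
  have "m < 2 ^ m" by simp
  also have "(2::nat) ^ m \<le> s ^ m" using \<open>2 \<le> s\<close> by (simp add: power_mono)
  finally show ?thesis by simp
qed (use s_pos in auto)

lemma m_le_s_pow_q: "m \<le> s ^ q"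
  unfolding q_def by (rule LeastI[of _ m]) (rule m_le_s_pow_m)

lemma q_le_m: "q \<le> m"
  unfolding q_def by (rule Least_le) (rule m_le_s_pow_m)

lemma pow_less_q: "k < q \<Longrightarrow> s ^ k < m"
  unfolding q_def using not_less_Least[of k "\<lambda>k. m \<le> s ^ k"] by simp

text \<open>By minimality the power without its last factor is below \<open>m\<close>, and the last
  factor is at most \<open>m\<close> because \<open>s\<close> is capped there.\<close>

lemma s_pow_q_le: "s ^ q \<le> m ^ 2"
proof (cases q)
  case 0
  then show ?thesis using nonempty by (simp add: Suc_le_eq)
next
  case (Suc k)
  then have "s ^ k \<le> m" using pow_less_q[of k] by simp
  moreover have "s \<le> m" by (simp add: s_def)
  ultimately show ?thesis unfolding Suc by (simp add: power2_eq_square mult_mono)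
qed

lemma S_le: "S \<le> m ^ (16 * R)"
proof -
  have "S = (s ^ q) ^ (8 * R)" by (simp add: S_def Q_def h_def power_mult[symmetric] ac_simps)
  also have "\<dots> \<le> (m ^ 2) ^ (8 * R)" by (intro power_mono s_pow_q_le) simp
  also have "\<dots> = m ^ (16 * R)" by (simp add: power_mult[symmetric])
  finally show ?thesis .
qed

text \<open>If \<open>q > 1\<close> then \<open>s = \<sigma>\<close>, since \<open>s = m\<close>
  reaches \<open>m\<close> with exponent 1 already; minimality then gives
  \<open>q - 1 < log \<sigma> m\<close>. The case \<open>q \<le> 1\<close> is absorbed by the
  maximum in \<open>log_factor\<close>.\<close>

lemma q_le_log_factor:
  assumes "2 \<le> m"
  shows "real q \<le> 2 * log_factor \<sigma> m"
proof (cases "q \<le> 1")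
  case True
  then show ?thesis by (auto simp: log_factor_def)
next
  case False
  then have q: "1 < q" by simp
  then have lt: "s ^ (q - 1) < m" using pow_less_q by simp
  have "s = \<sigma>"
  proof (rule ccontr)
    assume "s \<noteq> \<sigma>"
    then have "s = m" by (auto simp: s_def min_def split: if_splits)
    then have "m \<le> s ^ (q - 1)" using q nonempty by (metis self_le_power Suc_leI One_nat_def zero_less_diff)
    then show False using lt by simp
  qed
  then have "real \<sigma> ^ (q - 1) < real m" using lt by (metis of_nat_less_iff of_nat_power)
  then have "real \<sigma> powr real (q - 1) < real m" using sigma by (simp add: powr_realpow)
  then have "real (q - 1) < log \<sigma> m" using sigma assms by (subst less_log_iff) auto
  then have "real q \<le> 1 + log \<sigma> m" using q by linarith
  then show ?thesis by (simp add: log_factor_def max_def)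
qed

text \<open>A bound free of \<sigma>, which makes blocks no longer than the pattern once
  \<open>m\<close> is large.\<close>

lemma q_le_log2:
  assumes "2 \<le> m"
  shows "real q \<le> 1 + log 2 m"
proof (cases "q \<le> 1")
  case True
  moreover have "0 \<le> log 2 m" using assms by (subst zero_le_log_cancel_iff) auto
  ultimately show ?thesis by linarith
next
  case False
  then have "s ^ (q - 1) < m" using pow_less_q by simp
  moreover have "2 \<le> s" using sigma assms by (simp add: s_def)
  then have "2 ^ (q - 1) \<le> s ^ (q - 1)" by (intro power_mono) auto
  ultimately have "2 ^ (q - 1) < m" by linarith
  then have "(2::real) ^ (q - 1) < real m" by (metis of_nat_less_iff of_nat_power of_nat_numeral)
  then have "2 powr real (q - 1) < real m" by (simp add: powr_realpow)
  then have "real (q - 1) < log 2 m" using assms by (subst less_log_iff) auto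
  then show ?thesis using False by linarith
qed

lemma q_pos: "2 \<le> m \<Longrightarrow> 0 < q"
  using m_le_s_pow_q by (cases q) auto

lemma B_Q_le: "B * Q \<le> 2 * m + Q"
  by (simp add: B_def algebra_simps)

lemma less_B_Q: "0 < Q \<Longrightarrow> 2 * m < B * Q"
  using dividend_less_div_times[of Q "2 * m"] by (simp add: B_def algebra_simps)

section \<open>Counting hits and good blocks\<close>

definition solid :: "nat set" where "solid = {y. y < m \<and> x ! y \<noteq> None}"

lemma card_solid: "card solid + wildcards x = m"
proof -
  have "wildcards x = card {y. y < m \<and> x ! y = None}"
    by (simp add: wildcards_def count_list_eq_length_filter length_filter_conv_card eq_commute)
  moreover have "card solid + card {y. y < m \<and> x ! y = None} = card (solid \<union> {y. y < m \<and> x ! y = None})"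
    by (rule card_Un_disjoint[symmetric]) (auto simp: solid_def)
  moreover have "solid \<union> {y. y < m \<and> x ! y = None} = {..<m}" by (auto simp: solid_def)
  ultimately show ?thesis by simp
qed

text \<open>For a fixed alignment the blocks partition the positions of its solid characters, all of
  which lie below \<open>2 * m < B * Q\<close>; quotient and remainder modulo \<open>Q\<close>
  invert the map.\<close>

lemma sum_hits:
  assumes "0 < Q" "i < m"
  shows "(\<Sum>b<B. card (hits b i)) = card solid"
proof -
  have "(\<Sum>b<B. card (hits b i)) = card (SIGMA b:{..<B}. hits b i)"
    by (subst card_SigmaI) (auto simp: hits_def)
  also have "\<dots> = card solid"
  proof (rule bij_betw_same_card[where f = "\<lambda>(b, k). b * Q + k - i"], rule bij_betw_imageI)
    show "inj_on (\<lambda>(b, k). b * Q + k - i) (SIGMA b:{..<B}. hits b i)"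
    proof (rule inj_onI, clarify)
      fix b k b' k'
      assume k: "k \<in> hits b i" "k' \<in> hits b' i" and "b * Q + k - i = b' * Q + k' - i"
      then have eq: "b * Q + k = b' * Q + k'" and "k < Q" "k' < Q" by (auto simp: hits_def)
      have "(b * Q + k) div Q = b" "(b * Q + k) mod Q = k" using \<open>k < Q\<close> by simp_all
      moreover have "(b' * Q + k') div Q = b'" "(b' * Q + k') mod Q = k'" using \<open>k' < Q\<close> by simp_all
      ultimately      show "b = b' \<and> k = k'" using eq by metis
    qed
    show "(\<lambda>(b, k). b * Q + k - i) ` (SIGMA b:{..<B}. hits b i) = solid"
    proof (intro equalityI subsetI)
      fix y assume "y \<in> solid"
      then have y: "y < m" "x ! y \<noteq> None" by (auto simp: solid_def)
      define z where "z = i + y"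
      have "z < 2 * m" using y assms by (simp add: z_def)
      then have "z < B * Q" using less_B_Q assms by linarith
      then have zB: "z div Q < B" by (simp add: less_mult_imp_div_less)
      have zz: "z div Q * Q + z mod Q = z" by simp
      have "z mod Q \<in> hits (z div Q) i"
        using y assms(1) unfolding hits_def mem_Collect_eq zz by (simp add: z_def)
      then show "y \<in> (\<lambda>(b, k). b * Q + k - i) ` (SIGMA b:{..<B}. hits b i)"
        using zB zz by (intro image_eqI[of _ _ "(z div Q, z mod Q)"]) (auto simp: z_def)
    qed (auto simp: hits_def solid_def)
  qed
  finally show ?thesis .
qed

text \<open>A good block contains at most \<open>Q\<close> hits and any other block fewer than
  \<open>h\<close>.\<close>

lemma card_good_blocks:
  assumes "0 < Q" "i < m"
  shows "card solid \<le> card {b. b < B \<and> good b i} * Q + B * h"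
proof -
  have "card solid = (\<Sum>b<B. card (hits b i))" using sum_hits[OF assms] by simp
  also have "\<dots> \<le> (\<Sum>b<B. (if good b i then Q else 0) + h)"
  proof (rule sum_mono)
    fix b
    have "card (hits b i) \<le> Q" using card_mono[of "{..<Q}" "hits b i"] by (auto simp: hits_def)
    then show "card (hits b i) \<le> (if good b i then Q else 0) + h" by (auto simp: good_def)
  qed
  also have "\<dots> = card {b. b < B \<and> good b i} * Q + B * h"
    by (simp add: sum.distrib sum.If_cases lessThan_def Collect_conj_eq)
  finally show ?thesis .
qed

text \<open>\<open>E\<close> bounds the inverse density of the solid characters. As
  \<open>Q = 8 * E * h\<close>, the term \<open>E * B * h\<close> equals \<open>B * Q / 8\<close>,
  hence is at most \<open>3 * m / 8\<close>; the good blocks must supply the remaining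
  \<open>5 * m / 8\<close> of \<open>m\<close>, whereas \<open>B * Q \<le> 3 * m\<close>, and 6
  times 5/8 exceeds 3.\<close>

lemma good_fraction:
  assumes E: "R = 8 * E" "m \<le> card solid * E" and Q: "0 < Q" "Q \<le> m" and i: "i < m"
  shows "B \<le> 6 * E * card {b. b < B \<and> good b i}"
proof -
  define N where "N = card {b. b < B \<and> good b i}"
  have "E * card solid \<le> E * (N * Q + B * h)"
    using card_good_blocks[OF Q(1) i] by (simp add: N_def)
  then have 1: "m \<le> E * N * Q + E * B * h" using E(2) by (simp add: algebra_simps)
  have "Q = 8 * E * h" using Q_def E(1) by metis
  then have 2: "8 * (E * B * h) = B * Q" by simp
  have 3: "B * Q \<le> 3 * m" using B_Q_le Q(2) by simp
  have "B * Q \<le> 6 * (E * N * Q)" using 1 2 3 by linarith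
  then have "B * Q \<le> (6 * E * N) * Q" by (simp add: mult.assoc)
  then show ?thesis using Q(1) by (simp add: N_def del: mult.assoc)
qed

section \<open>Greedy cover by averaging\<close>

lemma gain_ge:
  assumes K: "\<And>i. i < m \<Longrightarrow> B \<le> K * card {b. b < B \<and> good b i}"
  shows "\<exists>b<B. card ({..<m} - C) \<le> K * gain C b"
proof (rule ccontr)
  assume "\<not> ?thesis"
  then have less: "K * gain C b < card ({..<m} - C)" if "b < B" for b using that by (auto simp: not_le)
  let ?U = "{..<m} - C"
  \<comment> \<open>Double counting of the pairs of an uncovered alignment and a block at which it
    is good: if every block gained less than the average, the total would be too small.\<close>
  have "B * card ?U = (\<Sum>i\<in>?U. B)" by simp
  also have "\<dots> \<le> (\<Sum>i\<in>?U. K * card {b. b < B \<and> good b i})" by (intro sum_mono K) auto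
  also have "\<dots> = K * (\<Sum>i\<in>?U. \<Sum>b<B. of_bool (good b i))"
    by (simp add: sum_distrib_left[symmetric] lessThan_def Collect_conj_eq of_bool_def sum.If_cases)
  also have "\<dots> = K * (\<Sum>b<B. \<Sum>i\<in>?U. of_bool (good b i))" by (subst sum.swap) simp
  also have "\<dots> = (\<Sum>b<B. K * gain C b)"
  proof -
    have "(\<Sum>i\<in>?U. of_bool (good b i)) = gain C b" for b
    proof -
      have "{i. i < m \<and> i \<notin> C \<and> good b i} = ?U \<inter> {i. good b i}" by auto
      then show ?thesis by (simp add: gain_def of_bool_def sum.If_cases)
    qed
    then show ?thesis by (simp add: sum_distrib_left)
  qed
  also have "\<dots> < (\<Sum>b<B. card ?U)" using less by (intro sum_strict_mono) (auto simp: B_def)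
  also have "\<dots> = B * card ?U" by simp
  finally show False by simp
qed

text \<open>Each step removes at least a fraction \<open>1 / K\<close> of the uncovered alignments.
  The second conjunct looks back to the state before the last step, when at least one alignment was
  uncovered, and thereby limits the length. The third records that each step gains at least one
  alignment.\<close>

lemma greedy_progress:
  assumes K: "\<And>C. \<exists>b<B. card ({..<m} - C) \<le> K * gain C b" "0 < K"
    and "greedy_seq bs"
  shows "real (card ({..<m} - covered bs)) \<le> m * (1 - 1 / K) ^ length bs \<and>
    (bs \<noteq> [] \<longrightarrow> 1 \<le> m * (1 - 1 / K) ^ (length bs - 1)) \<and> card ({..<m} - covered bs) + length bs \<le> m"
  using assms(3)
proof (induction rule: greedy_seq.induct)
  case Nil
  then show ?case by (simp add: covered_def)
next
  case (snoc bs b)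
  define U where "U = card ({..<m} - covered bs)"
  define U' where "U' = card ({..<m} - covered (bs @ [b]))"
  define g where "g = gain (covered bs) b"
  have "covered bs \<subseteq> {..<m}" by (auto simp: covered_def)
  then have U1: "1 \<le> U" using snoc.hyps(2) by (auto simp: U_def Suc_le_eq card_gt_0_iff)
  obtain b' where b': "b' < B" "U \<le> K * gain (covered bs) b'" using K(1) unfolding U_def by blast
  have "K * gain (covered bs) b' \<le> K * g" using snoc.hyps(4)[OF b'(1)] by (simp add: g_def)
  then have Ug: "U \<le> K * g" using b'(2) by linarith
  have sub: "{i. i < m \<and> i \<notin> covered bs \<and> good b i} \<subseteq> {..<m} - covered bs" by auto
  have eq: "{..<m} - covered (bs @ [b]) = ({..<m} - covered bs) - {i. i < m \<and> i \<notin> covered bs \<and> good b i}"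
    by (auto simp: covered_def)
  have "U' = U - g"
    unfolding U'_def U_def g_def eq gain_def by (rule card_Diff_subset[OF _ sub]) simp
  moreover have "g \<le> U" unfolding g_def gain_def U_def by (rule card_mono[OF _ sub]) simp
  ultimately have Ueq: "U' + g = U" by simp
  have g1: "1 \<le> g" using Ug U1 by (cases g) auto
  have IH: "real U \<le> m * (1 - 1 / K) ^ length bs" "U + length bs \<le> m"
    using snoc.IH by (auto simp: U_def)
  have "real U \<le> real K * real g" using Ug by (metis of_nat_le_iff of_nat_mult)
  then have "real U / real K \<le> real g" using K(2) by (simp add: field_simps)
  then have "real U' \<le> real U * (1 - 1 / K)" using Ueq by (simp add: algebra_simps)
  also have "\<dots> \<le> (m * (1 - 1 / K) ^ length bs) * (1 - 1 / K)"
    using IH(1) K(2) by (intro mult_right_mono) auto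
  finally have "real U' \<le> m * (1 - 1 / K) ^ length (bs @ [b])" by (simp add: mult_ac)
  moreover have "1 \<le> m * (1 - 1 / K) ^ length bs" using IH(1) U1 by linarith
  moreover have "U' + length (bs @ [b]) \<le> m" using IH(2) Ueq g1 by simp
  ultimately show ?case by (simp add: U'_def)
qed

text \<open>The geometric decay is compared with \<open>exp\<close> by means of
  \<open>1 - 1 / K \<le> exp (- 1 / K)\<close>; before the last step at least one of the
  \<open>m\<close> alignments was left.\<close>

lemma greedy_length:
  assumes K: "\<And>C. \<exists>b<B. card ({..<m} - C) \<le> K * gain C b" "0 < K"
    and "greedy_seq bs"
  shows "real (length bs) \<le> 1 + K * ln m"
proof (cases "bs = []")
  case True
  have "1 \<le> real m" using nonempty by linarith
  then show ?thesis using True by simp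
next
  case False
  have "1 \<le> m * (1 - 1 / K) ^ (length bs - 1)" using greedy_progress[OF assms] False by blast
  also have "(1 - 1 / K) ^ (length bs - 1) \<le> exp (- 1 / K) ^ (length bs - 1)"
    using K(2) exp_ge_add_one_self[of "- 1 / real K"] by (intro power_mono) auto
  also have "exp (- 1 / K) ^ (length bs - 1) = exp (- (real (length bs - 1) / K))"
    by (simp add: exp_of_nat_mult[symmetric])
  finally have "1 \<le> m * exp (- (real (length bs - 1) / K))" by (simp add: mult_left_mono)
  then have "exp (real (length bs - 1) / K) \<le> m" by (simp add: exp_minus field_simps)
  then have "real (length bs - 1) / K \<le> ln m" using nonempty by (subst ln_ge_iff) auto
  then have "real (length bs - 1) \<le> K * ln m" using K(2) by (simp add: field_simps)
  then show ?thesis by linarith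
qed

text \<open>The program performs \<open>m\<close> rounds; as every chosen block covers a new
  alignment, nothing can be left after \<open>m\<close> choices.\<close>

lemma greedy_covers:
  assumes K: "\<And>C. \<exists>b<B. card ({..<m} - C) \<le> K * gain C b" "0 < K"
    and "greedy_seq bs" "covered bs = {..<m} \<or> length bs = m"
  shows "covered bs = {..<m}"
proof (rule ccontr)
  assume "covered bs \<noteq> {..<m}"
  then have "card ({..<m} - covered bs) = 0" using greedy_progress[OF assms(1-3)] assms(4) by simp
  moreover have "covered bs \<subseteq> {..<m}" by (auto simp: covered_def)
  ultimately show False using \<open>covered bs \<noteq> {..<m}\<close> by auto
qed

text \<open>The residues of a block as digits in base \<open>s\<close>. Positions beyond the end of
  the text count as 0, which is what \<open>TextChar\<close> reads there.\<close>

definition code :: "nat list \<Rightarrow> nat \<Rightarrow> nat \<Rightarrow> nat" where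
  "code t v b = (\<Sum>k<Q. ((if v * m + (b * Q + k) < length t then t ! (v * m + (b * Q + k)) else 0) mod s) * s ^ k)"

lemma in_occurrences:
  "i \<in> occurrences x t \<longleftrightarrow> i + m \<le> length t \<and> (\<forall>k<m. x ! k = None \<or> x ! k = Some (t ! (i + k)))"
proof (cases "i + m \<le> length t")
  case True
  then have "length (take m (drop i t)) = m" by simp
  then show ?thesis
    using True unfolding occurrences_def matches_def list_all2_conv_all_nth corresponds_def
    by (auto simp del: length_take)
qed (auto simp: occurrences_def)

text \<open>The two bounds keep the addresses and intermediate values of both programs below
  \<open>2 ^ w\<close>. The table has at most about \<open>N = n ^ (16 * R + 2)\<close> cells up to
  a constant; all terms together stay within \<open>(25 * R + 25) * N\<close>, and since
  \<open>n \<ge> 2\<close> the coefficient is absorbed by \<open>n ^ (25 * R + 25)\<close>. The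
  exponent \<open>49 * R + 28\<close> leaves some slack.\<close>

lemma fits_bounds:
  assumes n: "m < n" and w: "n ^ (49 * R + 28) \<le> 2 ^ w"
  shows "2 * m + (B + 1) * S + (B + 2) * Q + m * m + 2 * m + R + h + 8 < 2 ^ w"
    and "2 * n + 4 * m + (B + 2) * Q + 8 < 2 ^ w"
proof -
  define N where "N = n ^ (16 * R + 2)"
  have n2: "2 \<le> n" using n nonempty by linarith
  have N: "n ^ k \<le> N" if "k \<le> 16 * R + 2" for k
    unfolding N_def using that n2 by (intro power_increasing) auto
  have n_le: "1 \<le> N" "n \<le> N" "n * n \<le> N" using N[of 0] N[of 1] N[of 2] by (simp_all add: power2_eq_square)
  have B4: "B + 1 \<le> 2 * n" "B + 2 \<le> 3 * n"
  proof -
    have "2 * m div Q \<le> 2 * m" by simp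
    then show "B + 1 \<le> 2 * n" "B + 2 \<le> 3 * n" using n n2 unfolding B_def by linarith+
  qed
  have qn: "q \<le> n" using q_le_m n by simp
  have "S \<le> n ^ (16 * R)" using S_le power_mono[of m n "16 * R"] n by simp
  then have "(B + 1) * S \<le> (2 * n) * n ^ (16 * R)" using B4 by (intro mult_mono) auto
  also have "\<dots> = 2 * n ^ (16 * R + 1)" by simp
  also have "\<dots> \<le> 2 * N" using N[of "16 * R + 1"] by simp
  finally have BS: "(B + 1) * S \<le> 2 * N" .
  have "Q \<le> 8 * R * n" using qn by (simp add: Q_def h_def)
  then have "(B + 2) * Q \<le> (3 * n) * (8 * R * n)" using B4 by (intro mult_mono) auto
  also have "\<dots> = 24 * R * (n * n)" by simp
  also have "\<dots> \<le> 24 * R * N" using n_le by (intro mult_left_mono) auto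
  finally have BQ: "(B + 2) * Q \<le> 24 * R * N" .
  have mm: "m * m \<le> N" using n_le(3) mult_mono[of m n m n] n by linarith
  have h: "h \<le> 8 * N" using qn n_le(2) by (simp add: h_def)
  have RN: "R \<le> R * N" using n_le(1) by simp
  have mN: "m \<le> N" using n n_le(2) by linarith
  have up: "(25 * R + 25) * N < 2 ^ w"
  proof -
    have "25 * R + 25 < 2 ^ (25 * R + 25)" by simp
    also have "(2::nat) ^ (25 * R + 25) \<le> n ^ (25 * R + 25)" using n2 by (intro power_mono) auto
    finally have "(25 * R + 25) * N < n ^ (25 * R + 25) * N" using n_le(1) by simp
    also have "\<dots> = n ^ (41 * R + 27)" unfolding N_def by (subst power_add[symmetric], rule arg_cong[where f = "(^) n"]) simp
    also have "\<dots> \<le> n ^ (49 * R + 28)" using n2 by (intro power_increasing) auto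
    finally show ?thesis using w by linarith
  qed
  have eq: "(25 * R + 25) * N = 24 * R * N + R * N + 25 * N" by (simp add: algebra_simps)
  show "2 * m + (B + 1) * S + (B + 2) * Q + m * m + 2 * m + R + h + 8 < 2 ^ w"
    using BS BQ mm h RN mN up n_le(1) unfolding eq by linarith
  show "2 * n + 4 * m + (B + 2) * Q + 8 < 2 ^ w"
    using BQ mN n_le(1,2) up unfolding eq by linarith
qed

end

section \<open>The preprocessing program\<close>

text \<open>
  The search program relies on registers below 9 being left alone by it. The number 1 is avoided
  because the simplifier rewrites it to \<^term>\<open>Suc 0\<close>. Besides the parameters of the locale \<open>probing\<close>,
  the registers hold: \<open>rP = s ^ q\<close>; \<open>rU\<close>, the number of alignments not yet covered; \<open>rG\<close>, the number of
  chosen blocks; for an alignment \<open>ri\<close>, a block \<open>rb\<close> and a content \<open>rx\<close>, the number \<open>rH\<close> of hits and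
  the consistency flag \<open>rC\<close>; \<open>rW = s ^ k\<close>; a table entry \<open>rE\<close>; the window \<open>rv\<close> and its flag \<open>rF\<close>.
\<close>

abbreviation (input) "rs \<equiv> 0 :: nat"
abbreviation (input) "rq \<equiv> 22 :: nat"
abbreviation (input) "rP \<equiv> 2 :: nat"
abbreviation (input) "rQ \<equiv> 3 :: nat"
abbreviation (input) "rS \<equiv> 4 :: nat"
abbreviation (input) "rB \<equiv> 5 :: nat"
abbreviation (input) "rU \<equiv> 6 :: nat"
abbreviation (input) "rG \<equiv> 7 :: nat"
abbreviation (input) "rh \<equiv> 8 :: nat"
abbreviation (input) "ri \<equiv> 9 :: nat"
abbreviation (input) "rk \<equiv> 10 :: nat"
abbreviation (input) "rH \<equiv> 11 :: nat"
abbreviation (input) "rC \<equiv> 12 :: nat"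
abbreviation (input) "rW \<equiv> 13 :: nat"
abbreviation (input) "rb \<equiv> 14 :: nat"
abbreviation (input) "rx \<equiv> 15 :: nat"
abbreviation (input) "rc \<equiv> 16 :: nat"
abbreviation (input) "rbc \<equiv> 17 :: nat"
abbreviation (input) "rbest \<equiv> 18 :: nat"
abbreviation (input) "rr \<equiv> 19 :: nat"
abbreviation (input) "rE \<equiv> 20 :: nat"
abbreviation (input) "ry \<equiv> 21 :: nat"
abbreviation (input) "rv \<equiv> 23 :: nat"
abbreviation (input) "rF \<equiv> 24 :: nat"
abbreviation (input) "rj \<equiv> 25 :: nat"

abbreviation (input) "incr r \<equiv> Assign r (Bin Add (Reg r) (Const 1))"

text \<open>The test \<open>ry < ri\<close> comes first so that the subtraction
  \<open>ry - ri\<close> cannot wrap around.\<close>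

definition probe :: com where
  "probe = Seq (Assign rH (Const 0)) (Seq (Assign rC (Const 1)) (Seq (Assign rW (Const 1))
    (For rk (Reg rQ)
      (Seq (Assign ry (Bin Add (Bin Mul (Reg rb) (Reg rQ)) (Reg rk)))
      (Seq (If (Bin Less (Reg ry) (Reg ri)) Skip
           (If (Bin Less (Reg ry) (Bin Add (Reg ri) PatLen))
             (If (Bin Eq (PatChar (Bin Sub (Reg ry) (Reg ri))) AlphSize) Skip
               (Seq (incr rH)
                 (If (Bin Eq (Bin Mod (PatChar (Bin Sub (Reg ry) (Reg ri))) (Reg rs))
                             (Bin Mod (Bin Div (Reg rx) (Reg rW)) (Reg rs)))
                   Skip (Assign rC (Const 0)))))
             Skip))
        (Assign rW (Bin Mul (Reg rW) (Reg rs))))))))"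

text \<open>The least exponent is found by \<open>m\<close> rounds that idle once the power has
  reached \<open>m\<close>; this suffices because \<open>m \<le> s ^ m\<close>.\<close>

definition setup_params :: "nat \<Rightarrow> com" where
  "setup_params R =
    Seq (If (Bin Less AlphSize PatLen) (Assign rs AlphSize) (Assign rs PatLen))
    (Seq (Assign rq (Const 0)) (Seq (Assign rP (Const 1))
    (Seq (For rr PatLen (If (Bin Less (Reg rP) PatLen)
            (Seq (Assign rP (Bin Mul (Reg rP) (Reg rs))) (incr rq)) Skip))
    (Seq (Assign rh (Bin Mul (Const 8) (Reg rq)))
    (Seq (Assign rQ (Bin Mul (Const R) (Reg rh)))
    (Seq (Assign rS (Const 1))
    (Seq (For rr (Reg rQ) (Assign rS (Bin Mul (Reg rS) (Reg rs))))
    (Assign rB (Bin Add (Bin Div (Bin Mul (Const 2) PatLen) (Reg rQ)) (Const 1))))))))))"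

definition count_gain :: com where
  "count_gain = Seq (Assign rc (Const 0))
     (For ri PatLen (Seq probe
       (If (Bin Less (Reg rH) (Reg rh)) Skip (If (Load (Reg ri)) Skip (incr rc)))))"

definition best_block :: com where
  "best_block = Seq (Assign rbc (Const 0)) (Seq (Assign rbest (Const 0))
    (For rb (Reg rB) (Seq count_gain
      (If (Bin Less (Reg rbc) (Reg rc))
        (Seq (Assign rbc (Reg rc)) (Assign rbest (Reg rb))) Skip))))"

definition mark_covered :: com where
  "mark_covered = For ri PatLen (Seq probe
     (If (Bin Less (Reg rH) (Reg rh)) Skip (Store (Reg ri) (Const 1))))"

text \<open>The loop idles once everything is covered. Since \<open>rU\<close> decreases by the gain
  of each chosen block, it ends up nonzero exactly if the cover is incomplete; the search relies on
  this.\<close>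

definition greedy :: com where
  "greedy = Seq (Assign rx (Const 0)) (Seq (Assign rU PatLen) (Seq (Assign rG (Const 0))
    (For rr PatLen (If (Reg rU)
      (Seq best_block
      (Seq (Store (Bin Add PatLen (Reg rG)) (Reg rbest))
      (Seq (incr rG)
      (Seq (Assign rb (Reg rbest))
      (Seq mark_covered
      (Assign rU (Bin Sub (Reg rU) (Reg rbc))))))))
      Skip))))"

text \<open>Alignments are scanned in increasing order and a nonzero entry is never overwritten, so
  that the least one is stored.\<close>

definition tabulate :: com where
  "tabulate = For rb (Reg rB) (For rx (Reg rS)
    (Seq (Assign rE (Const 0))
    (Seq (For ri PatLen (Seq probe
        (If (Bin Less (Reg rH) (Reg rh)) Skip
          (If (Reg rC) (If (Reg rE) Skip (Assign rE (Bin Add (Reg ri) (Const 1)))) Skip))))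
      (Store (Bin Add (Bin Mul (Const 2) PatLen) (Bin Add (Bin Mul (Reg rb) (Reg rS)) (Reg rx)))
        (Reg rE)))))"

text \<open>
  Memory layout: cell \<open>i < m\<close> is 1 iff alignment \<open>i\<close> is covered, cell \<open>m + j\<close> is the \<open>j\<close>-th chosen block,
  and cell \<open>2 m + b S + c\<close> is the table entry of block \<open>b\<close> and content \<open>c\<close>.
\<close>

definition preprocess :: "nat \<Rightarrow> com" where
  "preprocess R = Seq (setup_params R) (Seq greedy tabulate)"

section \<open>Correctness of the preprocessing\<close>

locale preprocessing = probing +
  fixes w :: nat
  assumes sigma_less: "\<sigma> < 2 ^ w"
    and fits: "2 * m + (B + 1) * S + (B + 2) * Q + m * m + 2 * m + R + h + 8 < 2 ^ w"
begin

abbreviation I :: inputs where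
  "I \<equiv> \<lparr>wordsize = w, alph = \<sigma>, pat = x, input_text = []\<rparr>"

lemma w_pos: "0 < w"
  using fits by (cases w) auto

lemma params_less: "(k::nat) \<le> 8 \<Longrightarrow> k < 2 ^ w" "m < 2 ^ w" "2 * m < 2 ^ w" "m * m < 2 ^ w" "R < 2 ^ w" "h < 2 ^ w"
  using fits by auto

lemma S_less: "S < 2 ^ w" and Q_less: "Q < 2 ^ w"
  using fits by auto

lemma B_less: "B < 2 ^ w"
proof -
  have "B \<le> 2 * m + 1" by (simp add: B_def)
  then show ?thesis using fits by linarith
qed

lemma pow_le_S: "k \<le> Q \<Longrightarrow> s ^ k \<le> S"
  unfolding S_def using s_pos by (simp add: power_increasing)

lemma pow_less: "k \<le> Q \<Longrightarrow> s ^ k < 2 ^ w"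
  using pow_le_S[of k] S_less by linarith

definition params :: "state \<Rightarrow> bool" where
  "params t \<longleftrightarrow> regs t rs = s \<and> regs t rQ = Q \<and> regs t rS = S \<and> regs t rB = B \<and> regs t rh = h"

lemma block_pos_less:
  assumes "b < B" "k < Q"
  shows "b * Q + k < 2 ^ w" "b * Q + k + m < 2 ^ w" "b * Q < 2 ^ w"
proof -
  have "(b + 1) * Q \<le> B * Q"
    using assms by (intro mult_right_mono) auto
  then have "b * Q + k < B * Q" using assms by (simp add: algebra_simps)
  with fits show "b * Q + k < 2 ^ w" "b * Q + k + m < 2 ^ w" "b * Q < 2 ^ w"
    by (auto simp: algebra_simps)
qed

lemma pat_char_None: "i < m \<Longrightarrow> x ! i = None \<Longrightarrow> pat_char I i = \<sigma>"
  by (simp add: pat_char_def)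

lemma pat_char_Some:
  assumes "i < m" "x ! i \<noteq> None"
  shows "pat_char I i = the (x ! i)" "the (x ! i) < \<sigma>"
  using assms pattern nth_mem[of i x] by (auto simp: pat_char_def is_pattern_def)

text \<open>The premise \<open>post\<close> accepts any cost, as the time of the preprocessing is
  not counted. The invariant restricts the hits to offsets already visited.\<close>

lemma wp_probe:
  assumes p: "params t" and b: "regs t rb = b" "b < B" and i: "regs t ri = i" "i < m"
    and c: "regs t rx = c" "c < S"
    and post: "\<And>k t'. same_except {rH,rC,rW,rk,ry} t t' \<Longrightarrow> regs t' rH = card (hits b i) \<Longrightarrow>
      regs t' rC = of_bool (consistent b i c) \<Longrightarrow> P k t'"
  shows "wp I probe P t"
proof -
  define hk where "hk k = {j \<in> hits b i. j < k}" for k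
  define ck where "ck k \<longleftrightarrow> (\<forall>j\<in>hk k. the (x ! (b * Q + j - i)) mod s = c div s ^ j mod s)" for k
  have hk0: "hk 0 = {}" and hkQ: "hk Q = hits b i" by (auto simp: hk_def hits_def)
  have hkS: "hk (Suc k) = (if k \<in> hits b i then insert k (hk k) else hk k)" for k
    by (auto simp: hk_def less_Suc_eq)
  have [simp]: "finite (hk k)" for k by (simp add: hk_def)
  have [simp]: "k \<notin> hk k" for k by (simp add: hk_def)
  have "hk k \<subseteq> {..<k}" for k by (auto simp: hk_def)
  then have card_hk: "card (hk k) \<le> k" for k
    using card_mono[of "{..<k}" "hk k"] by simp
  have ckS: "ck (Suc k) \<longleftrightarrow> ck k \<and>
    (k \<in> hits b i \<longrightarrow> the (x ! (b * Q + k - i)) mod s = c div s ^ k mod s)" for k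
    by (auto simp: ck_def hkS)
  define Inv where "Inv k (n::nat) t' \<longleftrightarrow> same_except {rH,rC,rW,rk,ry} t t' \<and> regs t' rH = card (hk k) \<and>
    regs t' rC = of_bool (ck k) \<and> regs t' rW = s ^ k" for k n t'
  show ?thesis
    unfolding probe_def wp_simps
    apply (rule wp_For[where N = Q and Inv = Inv])
    subgoal using Q_less by simp
    subgoal using w_pos by (simp add: Inv_def same_except_def hk0 ck_def)
    subgoal using p Q_less by (simp add: Inv_def same_except_def params_def)
    subgoal for k n t'
    proof -
      assume k: "k < Q" and inv: "Inv k n t'" and rk: "regs t' rk = k"
      note pos [simp] = block_pos_less[OF b(2) k] and rk [simp] = rk
      have sk [simp]: "s ^ k * s < 2 ^ w" "s * s ^ k < 2 ^ w" "s ^ k < 2 ^ w"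
        using pow_less[of "Suc k"] pow_less[of k] k by (auto simp: mult.commute)
      have [simp]: "b < 2 ^ w" "\<sigma> < 2 ^ w" "k < 2 ^ w" "Q < 2 ^ w" "i < 2 ^ w" "c < 2 ^ w" "s < 2 ^ w" "m < 2 ^ w"
        "1 < (2::nat) ^ w" "i + m < 2 ^ w" "0 < w"
        using k b B_less Q_less i c s_le params_less(2,3) S_less sigma_less w_pos pos by auto
      have [simp]: "regs t' rs = s" "regs t' rb = b" "regs t' rQ = Q" "regs t' ri = i" "regs t' rx = c"
        "regs t' rW = s ^ k" "regs t' rH = card (hk k)" "regs t' rC = of_bool (ck k)"
        using inv p b i c by (auto simp: Inv_def same_except_def params_def)
      have "card (hk k) + 1 \<le> Q" using card_hk[of k] k by simp
      then have [simp]: "Suc (card (hk k)) < 2 ^ w" "card (hk k) < 2 ^ w" using Q_less by linarith+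
      show ?thesis
      proof (cases "k \<in> hits b i")
        case True
        then have h [simp]: "i \<le> b * Q + k" "b * Q + k < i + m" "x ! (b * Q + k - i) \<noteq> None"
          by (auto simp: hits_def)
        then have y [simp]: "b * Q + k - i < m" "b * Q + k - i < 2 ^ w" "\<not> b * Q + k < i"
          using \<open>m < 2 ^ w\<close> by linarith+
        note pc [simp] = pat_char_Some[OF y(1) h(3)]
        have [simp]: "the (x ! (b * Q + k - i)) < 2 ^ w" using pc(2) sigma_less by linarith
        have [simp]: "the (x ! (b * Q + k - i)) \<noteq> \<sigma>" using pc(2) by linarith
        show ?thesis
          using inv True by (auto simp: wp_simps Inv_def same_except_def hkS ckS mult.commute)
      next
        case False
        \<comment> \<open>The three ways to miss a hit correspond to the three \<open>Skip\<close>
          branches of the program: left of the pattern, right of it, or on a wildcard.\<close>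
        consider "b * Q + k < i" | "i \<le> b * Q + k" "\<not> b * Q + k < i + m"
          | "i \<le> b * Q + k" "b * Q + k < i + m" "x ! (b * Q + k - i) = None"
          using False k by (force simp: hits_def)
        then show ?thesis
        proof cases
          case 3
          then have y [simp]: "b * Q + k - i < m" "b * Q + k - i < 2 ^ w" "\<not> b * Q + k < i"
            using \<open>m < 2 ^ w\<close> by linarith+
          note [simp] = 3 pat_char_None[OF y(1) 3(3)]
          show ?thesis
            using inv False by (auto simp: wp_simps Inv_def same_except_def hkS ckS mult.commute)
        qed (use inv False in \<open>auto simp: wp_simps Inv_def same_except_def hkS ckS mult.commute\<close>)
      qed
    qed
    subgoal using post by (simp add: Inv_def hkQ ck_def consistent_def)
    done
qed

lemma q_unique:
  assumes "m \<le> s ^ k" "\<And>j. j < k \<Longrightarrow> s ^ j < m"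
  shows "q = k"
  unfolding q_def by (rule Least_equality) (use assms in \<open>auto simp: not_less[symmetric]\<close>)

lemma wp_setup_params:
  assumes post: "\<And>k t'. params t' \<Longrightarrow> mem t' = mem t \<Longrightarrow> P k t'"
  shows "wp I (setup_params R) P t"
proof -
  \<comment> \<open>Either the power has reached \<open>m\<close> or every round so far has
    multiplied, so that the exponent equals the round number. The bound \<open>m * m\<close>
    excludes overflow: multiplication happens only below \<open>m\<close>, by a factor at most
    \<open>m\<close>.\<close>
  define Inv1 where "Inv1 r (n::nat) (t'::state) \<longleftrightarrow> regs t' rs = s \<and> mem t' = mem t \<and>
    regs t' rP = s ^ regs t' rq \<and> (\<forall>k<regs t' rq. s ^ k < m) \<and> s ^ regs t' rq \<le> m * m \<and>
    (m \<le> s ^ regs t' rq \<or> regs t' rq = r) \<and> regs t' rq \<le> r" for r n t'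
  define Inv2 where "Inv2 r (n::nat) (t'::state) \<longleftrightarrow> regs t' rs = s \<and> mem t' = mem t \<and>
    regs t' rh = h \<and> regs t' rQ = Q \<and> regs t' rS = s ^ r" for r n t'
  have [simp]: "w > 0" "m < 2 ^ w" "\<sigma> < 2 ^ w" "s < 2 ^ w" "8 < (2::nat) ^ w" "R < 2 ^ w" "h < 2 ^ w"
      "Q < 2 ^ w" "2 * m < 2 ^ w" "2 < (2::nat) ^ w" "Suc 0 < (2::nat) ^ w"
    using w_pos params_less(1)[of 8] params_less(1)[of 2] params_less(1)[of 1] params_less(2-) sigma_less s_le Q_less by auto
  have hq: "8 * q = h" and RQ: "R * h = Q" by (simp_all add: h_def Q_def)
  have BB: "Suc (2 * m div Q) = B" and B': "B < 2 ^ w" using B_less by (auto simp: B_def)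
  have Bm [simp]: "2 * m div Q < 2 ^ w" "Suc (2 * m div Q) < 2 ^ w" using B' BB by linarith+
  have 1: "wp I (If (Bin Less AlphSize PatLen) (Assign rs AlphSize) (Assign rs PatLen))
    (\<lambda>_ t'. regs t' rs = s \<and> mem t' = mem t) t"
    by (cases "\<sigma> < m") (simp_all add: wp_simps s_def min_def)
  show ?thesis
    unfolding setup_params_def wp_Seq wp_Assign
    apply (rule wp_mono[OF 1])
    subgoal for k0 t0
      apply (rule wp_For[where N = m and Inv = Inv1])
          apply simp
         apply (use nonempty in \<open>simp add: Inv1_def Suc_leI\<close>)
        apply simp
      subgoal for i n t'
      proof -
        assume i: "i < m" and inv: "Inv1 i n t'" and rr: "regs t' rr = i"
        define qq where "qq = regs t' rq"
        have Q [simp]: "regs t' rs = s" "regs t' rP = s ^ qq" "regs t' rq = qq"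
          using inv by (auto simp: Inv1_def qq_def)
        have lt: "s ^ qq \<le> m * m" "qq \<le> i" "\<forall>k<qq. s ^ k < m" "m \<le> s ^ qq \<or> qq = i"
          "mem t' = mem t"
          using inv unfolding Inv1_def Q by auto
        have [simp]: "s ^ qq < 2 ^ w" "qq < 2 ^ w" "Suc qq < 2 ^ w"
          using lt i params_less(2,4) by linarith+
        show ?thesis
        proof (cases "s ^ qq < m")
          case True
          then have "s ^ qq * s \<le> m * m" using s_le by (intro mult_mono) auto
          then have [simp]: "s ^ qq * s \<le> m * m" "s ^ qq * s < 2 ^ w" using params_less(4) by linarith+
          have "i = qq" using lt True by linarith
          then show ?thesis
            using True lt(1,3,5) rr by (simp add: wp_simps Inv1_def All_less_Suc mult.commute[of s])
        next
          case False
          then show ?thesis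
            using lt rr by (simp add: wp_simps Inv1_def)
        qed
      qed
      subgoal for n t'
      proof -
        assume inv: "Inv1 m n t'"
        have q [simp]: "regs t' rq = q"
        proof (rule q_unique[symmetric])
          show "m \<le> s ^ regs t' rq" using inv m_le_s_pow_m by (auto simp: Inv1_def)
          show "j < regs t' rq \<Longrightarrow> s ^ j < m" for j using inv by (auto simp: Inv1_def)
        qed
        have [simp]: "q < 2 ^ w" using hq \<open>h < 2 ^ w\<close> by linarith
        have [simp]: "regs t' rs = s" "mem t' = mem t" using inv by (simp_all add: Inv1_def)
        show ?thesis
          apply (rule wp_For[where N = Q and Inv = Inv2])
              apply simp
             apply (simp add: Inv2_def hq RQ)
            apply (simp add: Inv2_def)
          subgoal for i n' u
          proof -
            assume i: "i < Q" and inv: "Inv2 i n' u" and rr: "regs u rr = i"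
            have "s ^ i < 2 ^ w" "s ^ Suc i < 2 ^ w" using i by (simp_all only: pow_less Suc_leI less_imp_le)
            then show ?thesis using inv rr by (simp add: wp_simps Inv2_def mult.commute)
          qed
          subgoal for n' u
            by (intro post) (simp_all add: Inv2_def params_def S_def BB B')
          done
      qed
      done
    done
qed

definition marked :: "nat set \<Rightarrow> state \<Rightarrow> bool" where
  "marked C t \<longleftrightarrow> (\<forall>i<m. mem t i = of_bool (i \<in> C))"

lemma same_params: "same_except A t t' \<Longrightarrow> params t \<Longrightarrow> A \<inter> {rs,rQ,rS,rB,rh} = {} \<Longrightarrow> params t'"
  by (auto simp: same_except_def params_def)

lemma wp_count_gain:
  assumes p: "params t" and b: "regs t rb = b" "b < B" and x: "regs t rx = 0" and C: "marked C t"
    and post: "\<And>k t'. same_except {rc,ri,rH,rC,rW,rk,ry} t t' \<Longrightarrow> regs t' rc = gain C b \<Longrightarrow> P k t'"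
  shows "wp I count_gain P t"
proof -
  define gk where "gk i = {j. j < i \<and> j \<notin> C \<and> good b j}" for i
  have g0: "gk 0 = {}" by (simp add: gk_def)
  have [simp]: "finite (gk i)" "i \<notin> gk i" for i by (simp_all add: gk_def)
  have gS: "gk (Suc i) = (if i \<notin> C \<and> good b i then insert i (gk i) else gk i)" for i
    by (auto simp: gk_def less_Suc_eq)
  have "gk i \<subseteq> {..<i}" for i by (auto simp: gk_def)
  then have cg: "card (gk i) \<le> i" for i using card_mono[of "{..<i}" "gk i"] by simp
  define Inv where "Inv i (n::nat) (t'::state) \<longleftrightarrow> same_except {rc,ri,rH,rC,rW,rk,ry} t t' \<and> regs t' rc = card (gk i)" for i n t'
  have [simp]: "w > 0" "m < 2 ^ w" "h < 2 ^ w" using w_pos params_less by auto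
  have S0: "0 < S" using s_pos by (simp add: S_def)
  show ?thesis
    unfolding count_gain_def wp_simps
    apply (rule wp_For[where N = m and Inv = Inv])
        apply simp
       apply (simp add: Inv_def same_except_def g0)
      apply simp
    subgoal for i n t'
    proof -
      assume i: "i < m" and inv: "Inv i n t'" and ri: "regs t' ri = i"
      have s: "same_except {rc,ri,rH,rC,rW,rk,ry} t t'" using inv by (simp add: Inv_def)
      show ?thesis
        unfolding wp_Seq
      proof (rule wp_probe[where b = b and i = i and c = 0], goal_cases)
        case 1 show ?case by (rule same_params[OF s p]) auto
      next
        case (8 k t'')
        have "card (hits b i) \<le> Q"
          using card_mono[of "{..<Q}" "hits b i"] by (auto simp: hits_def)
        then have [simp]: "card (hits b i) < 2 ^ w" using Q_less by linarith
        have [simp]: "regs t'' rH = card (hits b i)" "regs t'' rh = h" "regs t'' ri = i"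
           "mem t'' i = of_bool (i \<in> C)" "mem t i = of_bool (i \<in> C)" "regs t'' rc = card (gk i)"
          using p ri i inv C 8(2)
          by (simp_all add: same_regs[OF 8(1)] same_regs[OF s] same_mem[OF 8(1)] same_mem[OF s] params_def marked_def Inv_def)
        have [simp]: "i < 2 ^ w" "card (gk i) < 2 ^ w" "Suc (card (gk i)) < 2 ^ w" "Suc 0 < 2 ^ w"
          using i cg[of i] \<open>m < 2 ^ w\<close> by linarith+
        have good: "good b i \<longleftrightarrow> \<not> card (hits b i) < h" by (auto simp: good_def)
        have "same_except {rc,ri,rH,rC,rW,rk,ry} t t''" by (rule same_trans[OF s 8(1)]) auto
        note s'' = this
        show ?case
          using s'' by (auto simp: wp_simps Inv_def gS good same_except_def)
      qed (use b x i ri S0 in \<open>simp_all add: same_regs[OF s]\<close>)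
    qed
    using post by (simp add: Inv_def gk_def gain_def)
qed

lemma wp_best_block:
  assumes p: "params t" and x: "regs t rx = 0" and C: "marked C t"
    and post: "\<And>k t'. same_except {rb,rbc,rbest,rc,ri,rH,rC,rW,rk,ry} t t' \<Longrightarrow> regs t' rbest < B \<Longrightarrow>
      (\<And>b. b < B \<Longrightarrow> gain C b \<le> gain C (regs t' rbest)) \<Longrightarrow> regs t' rbc = gain C (regs t' rbest) \<Longrightarrow> P k t'"
  shows "wp I best_block P t"
proof -
  let ?A = "{rb,rbc,rbest,rc,ri,rH,rC,rW,rk,ry}"
  define Inv where "Inv b (n::nat) (t'::state) \<longleftrightarrow> same_except ?A t t' \<and> regs t' rbest < B \<and>
    (\<forall>b'<b. gain C b' \<le> regs t' rbc) \<and>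
    (regs t' rbc = gain C (regs t' rbest) \<or> regs t' rbc = 0 \<and> regs t' rbest = 0)" for b n t'
  have gm: "gain C b \<le> m" for b
    unfolding gain_def using card_mono[of "{..<m}" "{i. i < m \<and> i \<notin> C \<and> good b i}"] by auto
  have g: "gain C b < 2 ^ w" for b
    using gm[of b] params_less(2) by linarith
  have B0: "0 < B" by (simp add: B_def)
  have [simp]: "w > 0" "B < 2 ^ w" using w_pos B_less by auto
  show ?thesis
    unfolding best_block_def wp_simps
    apply (rule wp_For[where N = B and Inv = Inv])
        apply simp
       apply (simp add: Inv_def same_except_def B0)
      apply (use p in \<open>simp add: Inv_def same_except_def params_def\<close>)
    subgoal for b n t'
    proof -
      assume b: "b < B" and inv: "Inv b n t'" and rb: "regs t' rb = b"
      have s: "same_except ?A t t'" using inv by (simp add: Inv_def)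
      show ?thesis
        unfolding wp_Seq
      proof (rule wp_count_gain[where b = b and C = C], goal_cases)
        case 1 show ?case by (rule same_params[OF s p]) auto
      next
        case (6 k t'')
        have [simp]: "regs t'' rc = gain C b" "regs t'' rbc = regs t' rbc" "regs t'' rbest = regs t' rbest"
          "regs t'' rb = b"
          using 6(2) rb by (simp_all add: same_regs[OF 6(1)])
        have [simp]: "regs t' rbc < 2 ^ w" using inv g by (auto simp: Inv_def)
        have [simp]: "b < 2 ^ w" using b \<open>B < 2 ^ w\<close> by linarith
        have "same_except ?A t t''" by (rule same_trans[OF s 6(1)]) auto
        note s'' = this
        show ?case
          using s'' inv b by (auto simp: wp_simps Inv_def same_except_def less_Suc_eq g)
      qed (use b x rb C in \<open>simp_all add: same_regs[OF s] marked_def same_mem[OF s]\<close>)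
    qed
    subgoal for k t'
    proof -
      assume "Inv B k t'"
      then have 1: "same_except ?A t t'" "regs t' rbest < B" "\<And>b. b < B \<Longrightarrow> gain C b \<le> regs t' rbc"
        "regs t' rbc = gain C (regs t' rbest) \<or> regs t' rbc = 0 \<and> regs t' rbest = 0"
        by (auto simp: Inv_def)
      \<comment> \<open>If no block has improved on the initial value 0, all gains are 0, in
        particular that of block 0, the initial value of \<open>rbest\<close>.\<close>
      have "regs t' rbc = gain C (regs t' rbest)" using 1(4) 1(3)[OF B0] by auto
      then show ?thesis using 1 by (intro post) auto
    qed
    done
qed

lemma wp_mark_covered:
  assumes p: "params t" and b: "regs t rb = b" "b < B" and x: "regs t rx = 0"
    and post: "\<And>k t'. \<forall>r. r \<notin> {ri,rH,rC,rW,rk,ry} \<longrightarrow> regs t' r = regs t r \<Longrightarrow>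
      mem t' = (\<lambda>a. if a < m \<and> good b a then 1 else mem t a) \<Longrightarrow> P k t'"
  shows "wp I mark_covered P t"
proof -
  let ?A = "{ri,rH,rC,rW,rk,ry}"
  define Inv where "Inv i (n::nat) (t'::state) \<longleftrightarrow> (\<forall>r. r \<notin> ?A \<longrightarrow> regs t' r = regs t r) \<and>
    mem t' = (\<lambda>a. if a < i \<and> good b a then 1 else mem t a)" for i n t'
  have [simp]: "w > 0" "m < 2 ^ w" "h < 2 ^ w" using w_pos params_less by auto
  have S0: "0 < S" using s_pos by (simp add: S_def)
  show ?thesis
    unfolding mark_covered_def
    apply (rule wp_For[where N = m and Inv = Inv])
        apply simp
       apply (simp add: Inv_def)
      apply simp
    subgoal for i n t'
    proof -
      assume i: "i < m" and inv: "Inv i n t'" and ri: "regs t' ri = i"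
      show ?thesis
        unfolding wp_Seq
      proof (rule wp_probe[where b = b and i = i and c = 0], goal_cases)
        case 1 show ?case using inv p by (auto simp: Inv_def params_def)
      next
        case (8 k t'')
        have "card (hits b i) \<le> Q"
          using card_mono[of "{..<Q}" "hits b i"] by (auto simp: hits_def)
        then have [simp]: "card (hits b i) < 2 ^ w" using Q_less by linarith
        have [simp]: "regs t'' rH = card (hits b i)" "regs t'' rh = h" "regs t'' ri = i"
          using p ri inv 8(2) by (simp_all add: same_regs[OF 8(1)] params_def Inv_def)
        have [simp]: "i < 2 ^ w" "Suc 0 < 2 ^ w"
          using i \<open>m < 2 ^ w\<close> by linarith+
        have good: "good b i \<longleftrightarrow> \<not> card (hits b i) < h" by (auto simp: good_def)
        show ?case
          using 8(1) inv by (auto simp: wp_simps Inv_def good same_except_def less_Suc_eq fun_eq_iff)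
      next
        case 2 then show ?case using inv b by (simp add: Inv_def)
      next
        case 6 then show ?case using inv x by (simp add: Inv_def)
      qed (use b i ri S0 in auto)
    qed
    using post by (simp add: Inv_def)
qed

definition chosen :: "nat list \<Rightarrow> state \<Rightarrow> bool" where
  "chosen bs t \<longleftrightarrow> regs t rG = length bs \<and> regs t rU = card ({..<m} - covered bs) \<and>
     (\<forall>j<length bs. mem t (m + j) = bs ! j) \<and> length bs \<le> m"

lemma wp_greedy:
  assumes p: "params t" and mem0: "mem t = (\<lambda>_. 0)"
    and post: "\<And>k t' bs. params t' \<Longrightarrow> greedy_seq bs \<Longrightarrow> chosen bs t' \<Longrightarrow>
      covered bs = {..<m} \<or> length bs = m \<Longrightarrow> P k t'"
  shows "wp I greedy P t"
proof -
  \<comment> \<open>Either the cover is complete and the rounds idle, or each round so far has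
    chosen one block.\<close>
  define Inv where "Inv r (n::nat) (t'::state) \<longleftrightarrow> params t' \<and> regs t' rx = 0 \<and>
    (\<exists>bs. greedy_seq bs \<and> chosen bs t' \<and> marked (covered bs) t' \<and> length bs \<le> r \<and>
       (covered bs = {..<m} \<or> length bs = r))" for r n t'
  have [simp]: "w > 0" "m < 2 ^ w" "2 * m < 2 ^ w" using w_pos params_less by auto
  show ?thesis
    unfolding greedy_def wp_Seq wp_Assign
    apply (rule wp_For[where N = m and Inv = Inv])
        apply simp
    subgoal
      unfolding Inv_def
      apply (intro conjI exI[of _ "[]"])
      using p mem0
            apply (simp_all add: params_def chosen_def marked_def covered_def greedy_seq.Nil)
      done
      apply simp
    subgoal for r n t'
    proof -
      assume r: "r < m" and inv: "Inv r n t'" and rr: "regs t' rr = r"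
      from inv obtain bs where bs: "params t'" "regs t' rx = 0" "greedy_seq bs" "chosen bs t'"
        "marked (covered bs) t'" "length bs \<le> r" "covered bs = {..<m} \<or> length bs = r"
        by (auto simp: Inv_def)
      have U: "regs t' rU = card ({..<m} - covered bs)" using bs(4) by (simp add: chosen_def)
      have cU: "card ({..<m} - covered bs) \<le> m"
        using card_mono[of "{..<m}" "{..<m} - covered bs"] by auto
      then have U_less: "card ({..<m} - covered bs) < 2 ^ w" using \<open>m < 2 ^ w\<close> by linarith
      then have [simp]: "expr_val I t' (Reg rU) = card ({..<m} - covered bs)" using U by simp
      show ?thesis
      proof (cases "covered bs = {..<m}")
        case True
        then have "Inv (Suc r) l (set_reg rr (Suc r) t')" for l
          unfolding Inv_def
          using bs by (intro conjI exI[of _ bs]) (simp_all add: params_def chosen_def marked_def)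
        then show ?thesis using True rr by (simp add: wp_If wp_Skip)
      next
        case False
        then have ne: "card ({..<m} - covered bs) \<noteq> 0" using covered_subset by auto
        then have len: "length bs = r" using bs(7) False by simp
        show ?thesis
          unfolding wp_If wp_Seq using ne apply simp
        proof (rule wp_best_block[OF bs(1,2,5)], goal_cases)
          case (1 k u)
          define b where "b = regs u rbest"
          have b1: "b < B" using 1(3) by (simp add: b_def)
          have b2: "gain (covered bs) b' \<le> gain (covered bs) b" if "b' < B" for b'
            unfolding b_def using that by (rule 1(4))
          note b = b1 b2
          have u [simp]: "regs u rbest = b" "regs u rbc = gain (covered bs) b" "regs u rG = r"
            "regs u rU = card ({..<m} - covered bs)" "regs u rx = 0" "regs u rr = r"
            using 1(5) rr bs(2,4) len by (simp_all add: b_def same_regs[OF 1(2)] chosen_def)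
          have gs: "greedy_seq (bs @ [b])"
            by (rule greedy_seq.snoc[OF bs(3) False b])
          have sub: "{i. i < m \<and> i \<notin> covered bs \<and> good b i} \<subseteq> {..<m} - covered bs" by auto
          \<comment> \<open>Ensures that the machine subtraction of the gain from \<open>rU\<close>
            does not wrap around.\<close>
          have gU: "gain (covered bs) b \<le> card ({..<m} - covered bs)"
            unfolding gain_def by (rule card_mono[OF _ sub]) simp
          have eq: "{..<m} - covered (bs @ [b]) = ({..<m} - covered bs) - {i. i < m \<and> i \<notin> covered bs \<and> good b i}"
            by (auto simp: covered_snoc)
          have card_eq: "card ({..<m} - covered (bs @ [b])) = card ({..<m} - covered bs) - gain (covered bs) b"
            unfolding eq gain_def by (rule card_Diff_subset[OF _ sub]) simp
          have [simp]: "b < 2 ^ w" "r < 2 ^ w" "Suc r < 2 ^ w" "Suc 0 < 2 ^ w" "m + r < 2 ^ w"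
            "gain (covered bs) b < 2 ^ w" "card ({..<m} - covered bs) < 2 ^ w"
            using b(1) B_less r \<open>m < 2 ^ w\<close> \<open>2 * m < 2 ^ w\<close> gU U_less by linarith+
          have pu: "params u" by (rule same_params[OF 1(2) bs(1)]) auto
          show ?case
            unfolding wp_Store wp_Assign
            apply simp
          proof (rule wp_mark_covered[where b = b], goal_cases)
            case 1 show ?case using pu by (simp add: params_def)
          next
            case (5 k' v)
            have v: "regs v rbc = gain (covered bs) b" "regs v rU = card ({..<m} - covered bs)" "regs v rr = r"
              "regs v rG = Suc r" "regs v rx = 0" "params v"
              using 5(1) pu by (simp_all add: params_def)
            have mv: "mem v a = (if a < m \<and> good b a then 1 else if a = m + r then b else mem t' a)" for a
              unfolding 5(2) using same_mem[OF 1(2)] by simp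
            define z where "z = v\<lparr>regs := (regs v)(6 := card ({..<m} - covered bs) - gain (covered bs) b, 19 := Suc r)\<rparr>"
            have "chosen (bs @ [b]) z"
              using bs(4) len r by (auto simp: chosen_def z_def v mv card_eq nth_append less_Suc_eq)
            moreover have "marked (covered (bs @ [b])) z"
              using bs(5) by (auto simp: marked_def z_def mv covered_snoc)
            moreover have "params z" "regs z rx = 0" using v by (simp_all add: z_def params_def)
            ultimately have "Inv (Suc r) l z" for l
              unfolding Inv_def using gs len by (intro conjI exI[of _ "bs @ [b]"]) auto
            then show ?case using v gU by (simp add: z_def)
          qed (use b in auto)
        qed
      qed
    qed
    subgoal for n t' using post by (auto simp: Inv_def)
    done
qed

lemma address_less:
  assumes "b < B" "c < S"
  shows "2 * m + (b * S + c) < 2 ^ w" "b * S + c < 2 ^ w" "b * S < 2 ^ w"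
proof -
  have "(b + 1) * S \<le> B * S"
    using assms by (intro mult_right_mono) auto
  then have "b * S + c < B * S" using assms by (simp add: algebra_simps)
  with fits show "2 * m + (b * S + c) < 2 ^ w" "b * S + c < 2 ^ w" "b * S < 2 ^ w"
    by (auto simp: algebra_simps)
qed

text \<open>The row-major layout orders the cells of the table strictly, so that storing an entry
  leaves the earlier ones intact.\<close>

lemma address_mono: "b' < b \<Longrightarrow> c' < S \<Longrightarrow> b' * S + c' < b * S + (c::nat)"
proof -
  assume "b' < b" "c' < S"
  then have "(b' + 1) * S \<le> b * S" by (intro mult_right_mono) auto
  then show ?thesis using \<open>c' < S\<close> by (simp add: algebra_simps)
qed

definition tabulated :: "nat \<Rightarrow> nat \<Rightarrow> state \<Rightarrow> bool" where
  "tabulated b c t \<longleftrightarrow> (\<forall>b' c'. c' < S \<and> (b' < b \<or> b' = b \<and> c' < c) \<longrightarrow>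
     entry m b' c' (mem t (2 * m + (b' * S + c'))))"

lemma wp_tabulate:
  assumes p: "params t" and bs: "chosen bs t"
    and post: "\<And>k t'. params t' \<Longrightarrow> chosen bs t' \<Longrightarrow> tabulated B 0 t' \<Longrightarrow> P k t'"
  shows "wp I tabulate P t"
proof -
  define Inv1 where "Inv1 b (n::nat) (t'::state) \<longleftrightarrow> params t' \<and> chosen bs t' \<and> tabulated b 0 t'" for b n t'
  define Inv2 where "Inv2 b c (n::nat) (t'::state) \<longleftrightarrow> params t' \<and> chosen bs t' \<and> tabulated b c t' \<and> regs t' rb = b"
    for b c n t'
  have [simp]: "w > 0" "m < 2 ^ w" "h < 2 ^ w" "2 * m < 2 ^ w" "2 < (2::nat) ^ w"
    using w_pos params_less params_less(1)[of 2] by auto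
  have [simp]: "S < 2 ^ w" "B < 2 ^ w" using S_less B_less by auto
  show ?thesis
    unfolding tabulate_def
    apply (rule wp_For[where N = B and Inv = Inv1])
        apply simp
       apply (use p bs in \<open>simp add: Inv1_def params_def chosen_def tabulated_def\<close>)
      apply (simp add: Inv1_def params_def)
    subgoal for b n t1
    proof -
      assume b: "b < B" and inv1: "Inv1 b n t1" and rb: "regs t1 rb = b"
      show ?thesis
        apply (rule wp_For[where N = S and Inv = "Inv2 b"])
            apply simp
           apply (use inv1 rb in \<open>simp add: Inv1_def Inv2_def params_def chosen_def tabulated_def\<close>)
          apply (simp add: Inv2_def params_def)
        subgoal for c n' t2
        proof -
          assume c: "c < S" and inv2: "Inv2 b c n' t2" and rx: "regs t2 rx = c"
          define Inv3 where "Inv3 i (n::nat) (t'::state) \<longleftrightarrow> same_except {rE,ri,rH,rC,rW,rk,ry} t2 t' \<and>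
            entry i b c (regs t' rE) \<and> regs t' rE \<le> i" for i n t'
          have p2: "params t2" "regs t2 rb = b" using inv2 by (auto simp: Inv2_def)
          show ?thesis
            unfolding wp_Seq wp_Assign
            apply (rule wp_For[where N = m and Inv = Inv3])
                apply simp
               apply (simp add: Inv3_def same_except_def entry_def)
              apply simp
            subgoal for i n3 t3
            proof -
              assume i: "i < m" and inv3: "Inv3 i n3 t3" and ri: "regs t3 ri = i"
              have s3: "same_except {rE,ri,rH,rC,rW,rk,ry} t2 t3" using inv3 by (simp add: Inv3_def)
              show ?thesis
                unfolding wp_Seq
              proof (rule wp_probe[where b = b and i = i and c = c], goal_cases)
                case 1 show ?case by (rule same_params[OF s3 p2(1)]) auto
              next
                case (8 k t4)
                have "card (hits b i) \<le> Q"
                  using card_mono[of "{..<Q}" "hits b i"] by (auto simp: hits_def)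
                then have [simp]: "card (hits b i) < 2 ^ w" using Q_less by linarith
                define e where "e = regs t3 rE"
                have r4 [simp]: "regs t4 rH = card (hits b i)" "regs t4 rC = of_bool (consistent b i c)"
                  "regs t4 rh = h" "regs t4 ri = i" "regs t4 rE = e"
                  using p2 ri 8(2,3)
                  by (simp_all add: same_regs[OF 8(1)] same_regs[OF s3] params_def e_def)
                have e: "entry i b c e" "e \<le> i" using inv3 by (auto simp: Inv3_def e_def)
                have [simp]: "i < 2 ^ w" "Suc i < 2 ^ w" "e < 2 ^ w" "Suc 0 < 2 ^ w"
                  using i e \<open>m < 2 ^ w\<close> by linarith+
                have [simp]: "(of_bool Z :: nat) < 2 ^ w" for Z by (cases Z) simp_all
                have good: "good b i \<longleftrightarrow> \<not> card (hits b i) < h" by (auto simp: good_def)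
                have s4: "same_except {rE,ri,rH,rC,rW,rk,ry} t2 t4" by (rule same_trans[OF s3 8(1)]) auto
                have en: "entry (Suc i) b c (if good b i \<and> consistent b i c \<and> e = 0 then Suc i else e)"
                  using e by (auto simp: entry_def less_Suc_eq)
                show ?case
                proof (cases "good b i \<and> consistent b i c \<and> e = 0")
                  case True
                  then show ?thesis
                    using s4 en by (simp add: wp_simps good Inv3_def) (simp add: same_except_def)
                next
                  case False
                  then show ?thesis
                    using s4 en e by (cases "good b i"; cases "consistent b i c")
                      (simp_all add: wp_simps good Inv3_def, simp_all add: same_except_def)
                qed
              qed (use b c i ri rx p2 in \<open>simp_all add: same_regs[OF s3]\<close>)
            qed
            subgoal for n3 t3
            proof -
              assume inv3: "Inv3 m n3 t3"
              have s3: "same_except {rE,ri,rH,rC,rW,rk,ry} t2 t3" using inv3 by (simp add: Inv3_def)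
              define e where "e = regs t3 rE"
              have e: "entry m b c e" "e \<le> m" using inv3 by (auto simp: Inv3_def e_def)
              note ad [simp] = address_less[OF b c]
              have [simp]: "regs t3 rE = e" "regs t3 rb = b" "regs t3 rx = c" "regs t3 rS = S"
                using p2 rx by (simp_all add: e_def same_regs[OF s3] params_def)
              have [simp]: "e < 2 ^ w" "b < 2 ^ w" "c < 2 ^ w"
                using e b c \<open>m < 2 ^ w\<close> \<open>S < 2 ^ w\<close> \<open>B < 2 ^ w\<close> by linarith+
              define z where "z = t3\<lparr>mem := (mem t3)(2 * m + (b * S + c) := e), regs := (regs t3)(15 := Suc c)\<rparr>"
              have "params z" using same_params[OF s3 p2(1)] by (simp add: z_def params_def)
              moreover have "chosen bs z"
                using inv2 by (auto simp: z_def chosen_def Inv2_def same_regs[OF s3] same_mem[OF s3])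
              moreover have "tabulated b (Suc c) z"
                using inv2 e(1) address_mono
                apply (auto simp: tabulated_def z_def Inv2_def same_mem[OF s3] less_Suc_eq)
                by (metis less_irrefl)
              ultimately have "Inv2 b (Suc c) l z" for l by (simp add: Inv2_def z_def)
              then show ?thesis using rx by (simp add: wp_Store z_def)
            qed
            done
        qed
        subgoal for n' t2
          by (auto simp: Inv1_def Inv2_def params_def chosen_def tabulated_def less_Suc_eq)
        done
    qed
    subgoal using post by (auto simp: Inv1_def)
    done
qed

text \<open>The last disjunction reflects the limit of \<open>m\<close> rounds; for patterns of
  sufficient density \<open>greedy_covers\<close> turns it into a complete cover.\<close>

lemma wp_preprocess:
  "wp I (preprocess R) (\<lambda>_ t. params t \<and> (\<exists>bs. greedy_seq bs \<and> chosen bs t \<and> tabulated B 0 t \<and>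
     (covered bs = {..<m} \<or> length bs = m))) init_state"
  unfolding preprocess_def wp_Seq
  apply (rule wp_setup_params)
  apply (rule wp_greedy, assumption, simp add: init_state_def)
  apply (rule wp_tabulate, assumption, assumption)
  by blast

end

section \<open>The search program\<close>

definition read_code :: com where
  "read_code = Seq (Assign rx (Const 0)) (Seq (Assign rW (Const 1))
    (For rk (Reg rQ)
      (Seq (Assign rx (Bin Add (Reg rx) (Bin Mul (Bin Mod (TextChar (Bin Add (Bin Mul (Reg rv) PatLen)
          (Bin Add (Bin Mul (Reg rb) (Reg rQ)) (Reg rk)))) (Reg rs)) (Reg rW))))
        (Assign rW (Bin Mul (Reg rW) (Reg rs))))))"

text \<open>Starting the flag with \<open>rU\<close> forces the naive check whenever the chosen
  blocks leave an alignment uncovered. As an entry \<open>e\<close> stands for alignment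
  \<open>e - 1\<close>, the comparison with \<open>TextLen + 2\<close> says that this alignment ends
  within the text, without any subtraction.\<close>

definition filter_window :: com where
  "filter_window = Seq (Assign rF (Reg rU))
    (For rj (Reg rG)
      (Seq (Assign rb (Load (Bin Add PatLen (Reg rj))))
      (Seq read_code
      (Seq (Assign rE (Load (Bin Add (Bin Mul (Const 2) PatLen) (Bin Add (Bin Mul (Reg rb) (Reg rS)) (Reg rx)))))
        (If (Reg rE)
          (If (Bin Less (Bin Add (Bin Mul (Reg rv) PatLen) (Bin Add (Reg rE) PatLen)) (Bin Add TextLen (Const 2)))
            (Assign rF (Const 1)) Skip)
          Skip)))))"

definition check_position :: com where
  "check_position = Seq (Assign rC (Const 1))
    (Seq (For rk PatLen
      (If (Bin Eq (PatChar (Reg rk)) AlphSize) Skip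
        (If (Bin Eq (PatChar (Reg rk)) (TextChar (Bin Add (Reg rc) (Reg rk)))) Skip (Assign rC (Const 0)))))
    (If (Reg rC) (Emit (Reg rc)) Skip))"

definition check_window :: com where
  "check_window = For ri PatLen
    (Seq (Assign rc (Bin Add (Bin Mul (Reg rv) PatLen) (Reg ri)))
      (If (Bin Less (Bin Add (Reg rc) PatLen) (Bin Add TextLen (Const 1))) check_position Skip))"

definition search :: com where
  "search = For rv (Bin Div TextLen PatLen)
    (Seq filter_window (If (Reg rF) check_window Skip))"

section \<open>Correctness and running time of the search\<close>

locale searching = preprocessing +
  fixes s0 :: state and bs :: "nat list" and n :: nat
  assumes params: "params s0" and greedy_bs: "greedy_seq bs" and chosen: "chosen bs s0"
    and tabulated: "tabulated B 0 s0" and m_less: "m < n"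
    and n_fits: "2 * n + 4 * m + (B + 2) * Q + 8 < 2 ^ w"
begin

abbreviation J :: "nat list \<Rightarrow> inputs" where
  "J t \<equiv> \<lparr>wordsize = w, alph = \<sigma>, pat = x, input_text = t\<rparr>"

text \<open>This is why the table stores the least alignment: if it extends past the end of the
  text, so does every other good consistent one, and the entry may be ignored.\<close>

definition lookup_hit :: "nat list \<Rightarrow> nat \<Rightarrow> nat \<Rightarrow> bool" where
  "lookup_hit t v b \<longleftrightarrow> mem s0 (2 * m + (b * S + code t v b)) \<noteq> 0 \<and>
     v * m + (mem s0 (2 * m + (b * S + code t v b)) + m) < n + 2"

definition flag :: "nat list \<Rightarrow> nat \<Rightarrow> bool" where
  "flag t v \<longleftrightarrow> covered bs \<noteq> {..<m} \<or> (\<exists>b\<in>set bs. lookup_hit t v b)"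

definition keeps_params :: "(nat \<Rightarrow> nat) \<Rightarrow> bool" where
  "keeps_params f \<longleftrightarrow> (\<forall>r<9. f r = regs s0 r)"

lemma keeps_params_upd [simp]: "9 \<le> r \<Longrightarrow> keeps_params (f(r := v)) = keeps_params f"
  by (auto simp: keeps_params_def)

lemma keeps_params_regs: "keeps_params f \<Longrightarrow> f rs = s \<and> f rQ = Q \<and> f rS = S \<and> f rU = card ({..<m} - covered bs) \<and> f rG = length bs"
  using params chosen by (auto simp: keeps_params_def params_def chosen_def)

lemma window_le: "v < n div m \<Longrightarrow> v * m + m \<le> n"
proof -
  assume "v < n div m"
  then have "(v + 1) * m \<le> (n div m) * m" by (intro mult_right_mono) auto
  also have "\<dots> \<le> n" by simp
  finally show ?thesis by simp
qed

context
  fixes t :: "nat list"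
  assumes t: "is_text \<sigma> t" "length t = n"
begin

lemma code_less_S: "code t v b < S"
  unfolding code_def S_def using s_pos by (intro code_less) auto

lemma text_char_J: "text_char (J t) i = (if i < length t then t ! i else 0)"
  by (simp add: text_char_def)

lemma text_char_less: "text_char (J t) i < \<sigma>"
  using t(1) sigma by (auto simp: text_char_def is_text_def subset_iff)

lemma wp_read_code:
  assumes v: "regs u rv = v" "v < n div m" and b: "regs u rb = b" "b < B" and l: "keeps_params (regs u)"
    and post: "\<And>k u'. k \<le> 40 * Q + 40 \<Longrightarrow> \<forall>r. r \<notin> {rx,rW,rk} \<longrightarrow> regs u' r = regs u r \<Longrightarrow>
      mem u' = mem u \<Longrightarrow> out u' = out u \<Longrightarrow> regs u' rx = code t v b \<Longrightarrow> P k u'"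
  shows "wp (J t) read_code P u"
proof -
  define d where "d k = text_char (J t) (v * m + (b * Q + k)) mod s" for k
  have d: "d k < s" for k using s_pos by (simp add: d_def)
  define Inv where "Inv k c (u'::state) \<longleftrightarrow> c \<le> 40 * k \<and> (\<forall>r. r \<notin> {rx,rW,rk} \<longrightarrow> regs u' r = regs u r) \<and>
      mem u' = mem u \<and> out u' = out u \<and> regs u' rx = (\<Sum>j<k. d j * s ^ j) \<and> regs u' rW = s ^ k" for k c u'
  have code: "code t v b = (\<Sum>j<Q. d j * s ^ j)"
    unfolding code_def d_def text_char_J ..
  have vm: "v * m + m \<le> n" using window_le v(2) .
  have [simp]: "w > 0" "Q < 2 ^ w" "s < 2 ^ w" "m < 2 ^ w" "b < 2 ^ w"
    using w_pos Q_less s_le sigma_less B_less b params_less(2) by auto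
  have vle: "v \<le> v * m" using mult_le_mono2[of 1 m v] nonempty by linarith
  have [simp]: "v < 2 ^ w" "v * m < 2 ^ w" using vm vle n_fits by linarith+
  show ?thesis
    unfolding read_code_def wp_Seq wp_Assign
    apply (rule wp_For[where N = Q and Inv = Inv])
        apply simp
       apply (simp add: Inv_def)
      apply (use keeps_params_regs[OF l] in \<open>simp add: Inv_def\<close>)
    subgoal for k c u'
    proof -
      assume k: "k < Q" and inv: "Inv k c u'" and rk: "regs u' rk = k"
      define E where "E = (\<Sum>j<k. d j * s ^ j)"
      \<comment> \<open>The digits read so far form a number below \<open>s ^ Suc k \<le> S\<close>,
        so the accumulator does not overflow.\<close>
      have E: "E + d k * s ^ k < s ^ Suc k"
        using code_less[of "Suc k" d s] d by (simp add: E_def)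
      then have E2: "E + d k * s ^ k < 2 ^ w" "d k * s ^ k < 2 ^ w" "E < 2 ^ w"
        using pow_less[of "Suc k"] k by linarith+
      have sk: "s ^ k * s < 2 ^ w" "s ^ k < 2 ^ w"
        using pow_less[of "Suc k"] pow_less[of k] k by (auto simp: mult.commute)
      have pos: "b * Q + k < 2 ^ w" "b * Q < 2 ^ w" using block_pos_less[OF b(2) k] by auto
      have "(b + 1) * Q \<le> B * Q" using b by (intro mult_right_mono) auto
      then have "b * Q + k < B * Q" using k by (simp add: algebra_simps)
      then have pos2: "v * m + (b * Q + k) < 2 ^ w" using vm n_fits by (simp add: algebra_simps)
      have [simp]: "k < 2 ^ w" using k \<open>Q < 2 ^ w\<close> by linarith
      have tc: "text_char (J t) i < 2 ^ w" for i using text_char_less[of i] sigma_less by linarith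
      have [simp]: "regs u' rs = s" "regs u' rQ = Q" "regs u' rx = E" "regs u' rW = s ^ k" "regs u' rk = k"
        "regs u' rv = v" "regs u' rb = b"
        using inv v b keeps_params_regs[OF l] rk by (simp_all add: Inv_def E_def)
      note [simp] = E2 sk pos pos2 tc d_def[symmetric]
      have "c \<le> 40 * k" using inv by (simp add: Inv_def)
      then show ?thesis
        using inv by (simp add: wp_simps Inv_def E_def[symmetric] mult.commute[of s])
    qed
    subgoal for c u' by (rule post) (auto simp: Inv_def code)
    done
qed

lemma wp_filter_window:
  assumes v: "regs u rv = v" "v < n div m" and l: "keeps_params (regs u)" "mem u = mem s0"
    and post: "\<And>k u'. k \<le> length bs * (40 * Q + 140) + 40 \<Longrightarrow> keeps_params (regs u') \<Longrightarrow> regs u' rv = v \<Longrightarrow> mem u' = mem s0 \<Longrightarrow>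
      out u' = out u \<Longrightarrow> regs u' rF < 2 ^ w \<Longrightarrow> (regs u' rF \<noteq> 0 \<longleftrightarrow> flag t v) \<Longrightarrow> P k u'"
  shows "wp (J t) filter_window P u"
proof -
  define Inv where "Inv j c (u'::state) \<longleftrightarrow> c \<le> j * (40 * Q + 140) \<and> keeps_params (regs u') \<and> regs u' rv = v \<and>
     mem u' = mem s0 \<and> out u' = out u \<and> regs u' rF < 2 ^ w \<and>
     (regs u' rF \<noteq> 0 \<longleftrightarrow> covered bs \<noteq> {..<m} \<or> (\<exists>j'<j. lookup_hit t v (bs ! j')))" for j c u'
  have vm: "v * m + m \<le> n" using window_le v(2) .
  have len: "length bs \<le> m" using chosen by (simp add: chosen_def)
  have cU: "card ({..<m} - covered bs) \<le> m"
    using card_mono[of "{..<m}" "{..<m} - covered bs"] by auto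
  have U0: "card ({..<m} - covered bs) = 0 \<longleftrightarrow> covered bs = {..<m}"
    using covered_subset by auto
  have [simp]: "w > 0" "S < 2 ^ w" "m < 2 ^ w" "2 * m < 2 ^ w" "2 < (2::nat) ^ w" "length bs < 2 ^ w"
    "card ({..<m} - covered bs) < 2 ^ w"
    using w_pos S_less params_less(2,3) params_less(1)[of 2] len cU by auto
  have vle: "v \<le> v * m" using mult_le_mono2[of 1 m v] nonempty by linarith
  have [simp]: "v < 2 ^ w" "v * m < 2 ^ w" "n < 2 ^ w" "Suc 0 < 2 ^ w" "Suc (Suc n) < 2 ^ w" "n + 2 < 2 ^ w"
    using vm vle n_fits by linarith+
  show ?thesis
    unfolding filter_window_def wp_Seq wp_Assign
    apply (rule wp_For[where N = "length bs" and Inv = Inv])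
        apply simp
       apply (use keeps_params_regs[OF l(1)] l v U0 in \<open>simp add: Inv_def\<close>)
    subgoal for j c u' using keeps_params_regs[of "regs u'"] by (simp add: Inv_def)
    subgoal for j c u'
    proof -
      assume j: "j < length bs" and inv: "Inv j c u'" and rj: "regs u' rj = j"
      define b where "b = bs ! j"
      have b: "b < B" using greedy_seq_less_B[OF greedy_bs] j by (auto simp: b_def subset_iff)
      have lu: "keeps_params (regs u')" "regs u' rv = v" "mem u' = mem s0" "out u' = out u" using inv by (auto simp: Inv_def)
      have mb [simp]: "mem s0 (m + j) = b" using chosen j by (simp add: chosen_def b_def)
      have [simp]: "b < 2 ^ w" using b B_less by linarith
      have [simp]: "j < 2 ^ w" "m + j < 2 ^ w"
        using j len \<open>m < 2 ^ w\<close> \<open>2 * m < 2 ^ w\<close> by linarith+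
      show ?thesis
        unfolding wp_Seq wp_Assign
      proof (rule wp_read_code[where v = v and b = b], goal_cases)
        case (6 k u2)
        define c' where "c' = code t v b"
        have c': "c' < S" by (simp add: c'_def code_less_S)
        define e where "e = mem s0 (2 * m + (b * S + c'))"
        have "entry m b c' e" using tabulated b c' by (simp add: tabulated_def e_def)
        then have em: "e \<le> m" by (auto simp: entry_def split: if_splits)
        note [simp] = address_less[OF b c']
        have lo: "keeps_params (regs u2)"
          using lu(1) 6(2) by (simp add: keeps_params_def)
        have [simp]: "regs u2 rb = b" "regs u2 rx = c'" "regs u2 rS = S" "regs u2 rv = v" "mem u2 = mem s0"
           "regs u2 rF = regs u' rF" "regs u2 rj = j" "out u2 = out u"
          using 6 keeps_params_regs[OF lo] lu rj by (simp_all add: c'_def)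
        have [simp]: "regs u' rF < 2 ^ w" using inv by (simp add: Inv_def)
        have [simp]: "e < 2 ^ w" "c' < 2 ^ w" "e + m < 2 ^ w" "v * m + (e + m) < 2 ^ w"
          using em c' S_less \<open>m < 2 ^ w\<close> vm n_fits by linarith+
        have te: "lookup_hit t v b \<longleftrightarrow> e \<noteq> 0 \<and> v * m + (e + m) < n + 2"
          by (simp add: lookup_hit_def e_def c'_def)
        have ex: "(\<exists>j'<Suc j. lookup_hit t v (bs ! j')) \<longleftrightarrow> (\<exists>j'<j. lookup_hit t v (bs ! j')) \<or> lookup_hit t v b"
          by (auto simp: less_Suc_eq b_def)
        have cc: "c \<le> j * (40 * Q + 140)" using inv by (simp add: Inv_def)
        have iff: "regs u' rF \<noteq> 0 \<longleftrightarrow> covered bs \<noteq> {..<m} \<or> (\<exists>j'<j. lookup_hit t v (bs ! j'))"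
          using inv by (simp add: Inv_def)
        consider "e = 0" | "e \<noteq> 0" "v * m + (e + m) < n + 2" | "e \<noteq> 0" "\<not> v * m + (e + m) < n + 2" by blast
        then show ?case
        proof cases
          case 1
          then show ?thesis
            apply (simp add: wp_simps e_def[symmetric] t(2))
            using cc 6(1) iff lo apply (simp add: Inv_def ex te)
            done
        next
          case 2
          then show ?thesis
            apply (simp add: wp_simps e_def[symmetric] t(2))
            using cc 6(1) iff lo apply (simp add: Inv_def ex te)
            done
        next
          case 3
          then show ?thesis
            apply (simp add: wp_simps e_def[symmetric] t(2))
            using cc 6(1) iff lo apply (simp add: Inv_def ex te)
            done
        qed
      qed (use v b lu rj in simp_all)
    qed
    subgoal for c u'
    proof -
      assume inv: "Inv (length bs) c u'"
      have "(\<exists>j<length bs. lookup_hit t v (bs ! j)) \<longleftrightarrow> (\<exists>b\<in>set bs. lookup_hit t v b)"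
        by (metis in_set_conv_nth)
      then show ?thesis using inv by (intro post) (simp_all add: Inv_def flag_def)
    qed
    done
qed

lemma wp_check_position:
  assumes c: "regs u rc = c" "c + m \<le> n"
    and post: "\<And>k u'. k \<le> 40 * m + 40 \<Longrightarrow> \<forall>r. r \<notin> {rk,rC} \<longrightarrow> regs u' r = regs u r \<Longrightarrow>
      mem u' = mem u \<Longrightarrow> out u' = out u @ (if c \<in> occurrences x t then [c] else []) \<Longrightarrow> P k u'"
  shows "wp (J t) check_position P u"
proof -
  define ok where "ok k \<longleftrightarrow> (\<forall>j<k. x ! j = None \<or> x ! j = Some (t ! (c + j)))" for k
  define Inv where "Inv k l (u'::state) \<longleftrightarrow> l \<le> 30 * k \<and> (\<forall>r. r \<notin> {rk,rC} \<longrightarrow> regs u' r = regs u r) \<and>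
      mem u' = mem u \<and> out u' = out u \<and> regs u' rC = of_bool (ok k)" for k l u'
  have occ: "c \<in> occurrences x t \<longleftrightarrow> ok m" using c(2) by (simp add: in_occurrences t(2) ok_def)
  have [simp]: "w > 0" "m < 2 ^ w" using w_pos params_less(2) by auto
  have [simp]: "c < 2 ^ w" "Suc 0 < 2 ^ w" using c(2) n_fits by linarith+
  show ?thesis
    unfolding check_position_def wp_Seq wp_Assign
    apply (rule wp_For[where N = m and Inv = Inv])
        apply simp
       apply (simp add: Inv_def ok_def)
      apply simp
    subgoal for k l u'
    proof -
      assume k: "k < m" and inv: "Inv k l u'" and rk: "regs u' rk = k"
      have okS: "ok (Suc k) \<longleftrightarrow> ok k \<and> (x ! k = None \<or> x ! k = Some (t ! (c + k)))"
        by (auto simp: ok_def less_Suc_eq)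
      have [simp]: "k < 2 ^ w" "c + k < 2 ^ w" "\<sigma> < 2 ^ w" using k c(2) n_fits sigma_less by linarith+
      have tc [simp]: "text_char (J t) (c + k) = t ! (c + k)" using k c(2) t(2) by (simp add: text_char_def)
      have [simp]: "t ! (c + k) < 2 ^ w" using text_char_less[of "c + k"] sigma_less unfolding tc by linarith
      have pc: "pat_char (J t) k = pat_char I k" by (simp add: pat_char_def split: option.split)
      have [simp]: "regs u' rk = k" "regs u' rc = c" "regs u' rC = of_bool (ok k)"
        using inv rk c by (simp_all add: Inv_def)
      have l: "l \<le> 30 * k" using inv by (simp add: Inv_def)
      show ?thesis
      proof (cases "x ! k")
        case None
        then have [simp]: "pat_char (J t) k = \<sigma>" using pat_char_None[OF k] pc by simp
        show ?thesis
          apply (simp add: wp_simps)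
          using inv l None by (simp add: Inv_def okS)
      next
        case (Some a)
        then have a: "pat_char (J t) k = a" "a < \<sigma>" using pat_char_Some[OF k] pc by simp_all
        then have [simp]: "pat_char (J t) k = a" "a < 2 ^ w" "a \<noteq> \<sigma>" using sigma_less by linarith+
        show ?thesis
        proof (cases "a = t ! (c + k)")
          case True
          show ?thesis
            apply (simp add: wp_simps True)
            using inv l Some True by (simp add: Inv_def okS)
        next
          case False
          then show ?thesis
            apply (simp add: wp_simps)
            using inv l Some False by (simp add: Inv_def okS)
        qed
      qed
    qed
    subgoal for l u'
    proof -
      assume inv: "Inv m l u'"
      then have [simp]: "regs u' rC = of_bool (ok m)" "regs u' rc = c" using c by (simp_all add: Inv_def)
      have [simp]: "(of_bool Z :: nat) < 2 ^ w" for Z by (cases Z) simp_all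
      show ?thesis
      proof (cases "ok m")
        case True
        then show ?thesis apply (simp add: wp_simps)
          by (rule post) (use inv occ True in \<open>simp_all add: Inv_def\<close>)
      next
        case False
        then show ?thesis apply (simp add: wp_simps)
          by (rule post) (use inv occ False in \<open>simp_all add: Inv_def\<close>)
      qed
    qed
    done
qed

lemma wp_check_window:
  assumes v: "regs u rv = v" "v < n div m" and l: "keeps_params (regs u)"
    and post: "\<And>k u'. k \<le> m * (40 * m + 100) + 40 \<Longrightarrow> keeps_params (regs u') \<Longrightarrow> regs u' rv = v \<Longrightarrow>
      mem u' = mem u \<Longrightarrow> set (out u') = set (out u) \<union> {i \<in> occurrences x t. v * m \<le> i \<and> i < v * m + m} \<Longrightarrow> P k u'"
  shows "wp (J t) check_window P u"
proof -
  define Inv where "Inv i c (u'::state) \<longleftrightarrow> c \<le> i * (40 * m + 100) \<and> keeps_params (regs u') \<and> regs u' rv = v \<and>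
      mem u' = mem u \<and> set (out u') = set (out u) \<union> {j \<in> occurrences x t. v * m \<le> j \<and> j < v * m + i}" for i c u'
  have vm: "v * m + m \<le> n" using window_le v(2) .
  have vle: "v \<le> v * m" using mult_le_mono2[of 1 m v] nonempty by linarith
  have [simp]: "w > 0" "m < 2 ^ w" using w_pos params_less(2) by auto
  have [simp]: "v < 2 ^ w" "v * m < 2 ^ w" "Suc 0 < 2 ^ w" "Suc n < 2 ^ w" "n < 2 ^ w" using vm vle n_fits by linarith+
  have e0: "{j \<in> occurrences x t. v * m \<le> j \<and> j < v * m} = {}" by auto
  show ?thesis
    unfolding check_window_def
    apply (rule wp_For[where N = m and Inv = Inv])
        apply simp
       apply (use v l in \<open>simp add: Inv_def e0\<close>)
      apply simp
    subgoal for i c u'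
    proof -
      assume i: "i < m" and inv: "Inv i c u'" and ri: "regs u' ri = i"
      have [simp]: "i < 2 ^ w" "v * m + i < 2 ^ w" "v * m + i + m < 2 ^ w"
        using i vm n_fits by linarith+
      have [simp]: "regs u' rv = v" "regs u' ri = i" using inv ri by (simp_all add: Inv_def)
      have set: "{j \<in> occurrences x t. v * m \<le> j \<and> j < v * m + Suc i} =
        {j \<in> occurrences x t. v * m \<le> j \<and> j < v * m + i} \<union> (if v * m + i \<in> occurrences x t then {v * m + i} else {})"
        by (auto simp: less_Suc_eq)
      show ?thesis
      proof (cases "v * m + i + m \<le> n")
        case True
        then have "v * m + i + m < Suc n" by simp
        then show ?thesis
          apply (simp add: wp_simps t(2))
          apply (rule wp_check_position[where c = "v * m + i"])
            apply simp
           apply (rule True)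
          using inv ri set apply (simp add: Inv_def keeps_params_def)
          done
      next
        case False
        then have "\<not> v * m + i + m < Suc n" by simp
        moreover have "v * m + i \<notin> occurrences x t" using False by (simp add: in_occurrences t(2))
        ultimately show ?thesis
          apply (simp add: wp_simps t(2))
          using inv ri set apply (simp add: Inv_def)
          done
      qed
    qed
    subgoal for c u'
      by (rule post) (simp_all add: Inv_def)
    done
qed

text \<open>An occurrence is consistent with the content of a chosen block at which its alignment is
  good, so the table entry there is nonzero and stands for an alignment not beyond it, which
  therefore fits into the text as well.\<close>

lemma not_flag_occurrence:
  assumes "\<not> flag t v" "v * m \<le> i" "i < v * m + m" "v < n div m"
  shows "i \<notin> occurrences x t"
proof
  assume occ: "i \<in> occurrences x t"
  define i' where "i' = i - v * m"
  have i': "i' < m" "i = v * m + i'" using assms by (auto simp: i'_def)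
  have "covered bs = {..<m}" using assms(1) by (simp add: flag_def)
  then have "i' \<in> covered bs" using i' by simp
  then obtain b where b: "b \<in> set bs" "good b i'" by (auto simp: covered_def)
  then have bB: "b < B" using greedy_seq_less_B[OF greedy_bs] by auto
  have im: "i + m \<le> n" "\<And>k. k < m \<Longrightarrow> x ! k = None \<or> x ! k = Some (t ! (i + k))"
    using occ by (auto simp: in_occurrences t(2))
  define d where "d k = (if v * m + (b * Q + k) < length t then t ! (v * m + (b * Q + k)) else 0) mod s" for k
  have cons: "consistent b i' (code t v b)"
    unfolding consistent_def
  proof
    fix k assume k: "k \<in> hits b i'"
    then have k': "k < Q" "i' \<le> b * Q + k" "b * Q + k < i' + m" "x ! (b * Q + k - i') \<noteq> None"
      by (auto simp: hits_def)
    have "i + (b * Q + k - i') = v * m + (b * Q + k)" using i' k' by simp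
    then have "x ! (b * Q + k - i') = Some (t ! (v * m + (b * Q + k)))"
      using im(2)[of "b * Q + k - i'"] k' by auto
    moreover have "v * m + (b * Q + k) < length t" using k' i' im(1) t(2) by linarith
    moreover have "code t v b div s ^ k mod s = d k"
      unfolding code_def d_def by (rule code_digit) (use s_pos k' in auto)
    ultimately show "the (x ! (b * Q + k - i')) mod s = code t v b div s ^ k mod s"
      by (simp add: d_def)
  qed
  define e where "e = mem s0 (2 * m + (b * S + code t v b))"
  have en: "entry m b (code t v b) e"
    using tabulated bB code_less_S by (simp add: tabulated_def e_def)
  have e0: "e \<noteq> 0"
    using en i'(1) b(2) cons by (auto simp: entry_def split: if_splits)
  have "\<not> i' < e - 1"
    using en e0 b(2) cons by (auto simp: entry_def split: if_splits)
  then have "v * m + (e + m) < n + 2" using im(1) i' by linarith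
  then have "lookup_hit t v b" using e0 by (simp add: lookup_hit_def e_def)
  then show False using assms(1) b by (auto simp: flag_def)
qed

text \<open>With a complete cover the flag can only stem from a lookup. As the alignment found fits
  into the text, all its hits are genuine text positions rather than default zeros, so that
  randomness of the letters applies to them.\<close>

lemma flag_witness:
  assumes "flag t v" "covered bs = {..<m}"
  shows "\<exists>b\<in>set bs. \<exists>i<m. good b i \<and> v * m + i + m \<le> n \<and>
    (\<forall>k\<in>hits b i. t ! (v * m + (b * Q + k)) mod s = the (x ! (b * Q + k - i)) mod s)"
proof -
  obtain b where b: "b \<in> set bs" "lookup_hit t v b" using assms by (auto simp: flag_def)
  then have bB: "b < B" using greedy_seq_less_B[OF greedy_bs] by auto
  define e where "e = mem s0 (2 * m + (b * S + code t v b))"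
  have "entry m b (code t v b) e"
    using tabulated bB code_less_S by (simp add: tabulated_def e_def)
  moreover have e: "e \<noteq> 0" "v * m + e + m < n + 2" using b(2) by (auto simp: lookup_hit_def e_def)
  ultimately have e2: "e \<le> m" "good b (e - 1)" "consistent b (e - 1) (code t v b)"
    by (simp_all add: entry_def)
  have *: "t ! (v * m + (b * Q + k)) mod s = the (x ! (b * Q + k - (e - 1))) mod s" if k: "k \<in> hits b (e - 1)" for k
  proof -
    have k': "k < Q" "b * Q + k < e - 1 + m" using k by (auto simp: hits_def)
    then have lt: "v * m + (b * Q + k) < length t" using e t(2) by linarith
    define d where "d k = (if v * m + (b * Q + k) < length t then t ! (v * m + (b * Q + k)) else 0) mod s" for k
    have "code t v b div s ^ k mod s = d k"
      unfolding code_def d_def by (rule code_digit) (use s_pos k' in auto)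
    then show ?thesis using e2(3) k lt by (auto simp: consistent_def d_def)
  qed
  have "e - 1 < m" "v * m + (e - 1) + m \<le> n" using e e2(1) by linarith+
  then show ?thesis using b(1) e2(2) * by blast
qed

definition window_cost :: "nat \<Rightarrow> nat" where
  "window_cost v = length bs * (40 * Q + 140) + 100 + (if flag t v then m * (40 * m + 100) + 40 else 0)"

lemma wp_search:
  "wp (J t) search (\<lambda>k u. k \<le> (\<Sum>v<n div m. window_cost v) + 40 \<and> set (out u) = occurrences x t) (s0\<lparr>out := []\<rparr>)"
proof -
  define Inv where "Inv v c (u::state) \<longleftrightarrow> c \<le> (\<Sum>v'<v. window_cost v') \<and> keeps_params (regs u) \<and> mem u = mem s0 \<and>
    set (out u) = {i \<in> occurrences x t. i < v * m}" for v c u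
  have "n div m \<le> n" by simp
  then have [simp]: "w > 0" "m < 2 ^ w" "n < 2 ^ w" "n div m < 2 ^ w"
    using w_pos params_less(2) n_fits by (simp, simp, linarith, linarith)
  show ?thesis
    unfolding search_def
    apply (rule wp_For[where N = "n div m" and Inv = Inv])
        apply simp
       apply (simp add: Inv_def keeps_params_def)
      apply (simp add: t(2))
    subgoal for v c u
    proof -
      assume v: "v < n div m" and inv: "Inv v c u" and rv: "regs u rv = v"
      have spl: "{i \<in> occurrences x t. i < Suc v * m} =
        {i \<in> occurrences x t. i < v * m} \<union> {i \<in> occurrences x t. v * m \<le> i \<and> i < v * m + m}"
        by auto
      show ?thesis
        unfolding wp_Seq
      proof (rule wp_filter_window[where v = v], goal_cases)
        case (5 k u')
        then have [simp]: "expr_val (J t) u' (Reg rF) = regs u' rF" by simp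
        have c: "c \<le> (\<Sum>v'<v. window_cost v')" using inv by (simp add: Inv_def)
        show ?case
        proof (cases "flag t v")
          case True
          then have "regs u' rF \<noteq> 0" using 5 by simp
          then show ?thesis
            apply (simp add: wp_If)
            apply (rule wp_check_window[OF 5(3) v 5(2)])
            using c 5(1,4,5) True inv apply (simp add: Inv_def window_cost_def spl del: mult_Suc)
            done
        next
          case False
          then have "regs u' rF = 0" using 5 by simp
          moreover have emp: "{i \<in> occurrences x t. v * m \<le> i \<and> i < v * m + m} = {}"
            using not_flag_occurrence[OF False _ _ v] by auto
          ultimately show ?thesis
            apply (simp add: wp_If wp_Skip)
            using c 5(1-5) False inv spl[unfolded emp Un_empty_right] apply (simp add: Inv_def window_cost_def del: mult_Suc)
            done
        qed
      qed (use v rv inv in \<open>simp_all add: Inv_def\<close>)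
    qed
    subgoal for c u
    proof -
      assume inv: "Inv (n div m) c u"
      \<comment> \<open>The last possible start \<open>n - m\<close> still belongs to a window,
        because \<open>n mod m < m\<close>.\<close>
      have "i < n div m * m" if "i \<in> occurrences x t" for i
      proof -
        have "i + m \<le> n" using that by (simp add: in_occurrences t(2))
        moreover have "n div m * m + n mod m = n" "n mod m < m" using nonempty by simp_all
        ultimately show ?thesis by linarith
      qed
      then show ?thesis using inv by (auto simp: Inv_def)
    qed
    done
qed

end
end

section \<open>The expected search time\<close>

text \<open>Independence of the letters in product form, by splitting off the first letter of the
  text.\<close>

lemma measure_random_text:
  "measure (random_text \<sigma> n) {t. \<forall>y<n. t ! y \<in> A y} = (\<Prod>y<n. measure (pmf_of_set {..<\<sigma>}) (A y))"
proof (induction n arbitrary: A)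
  case 0
  then show ?case by (simp add: random_text_def)
next
  case (Suc n)
  let ?p = "pmf_of_set {..<\<sigma>} :: nat pmf"
  have eq: "random_text \<sigma> (Suc n) = map_pmf (\<lambda>(a, t). a # t) (pair_pmf ?p (random_text \<sigma> n))"
    by (simp add: random_text_def pair_pmf_def map_bind_pmf map_pmf_def bind_assoc_pmf bind_return_pmf)
  have vim: "(\<lambda>(a, t). a # t) -` {t. \<forall>y<Suc n. t ! y \<in> A y} = A 0 \<times> {t. \<forall>y<n. t ! y \<in> A (Suc y)}"
    by (auto simp: less_Suc_eq_0_disj)
  have "measure (random_text \<sigma> (Suc n)) {t. \<forall>y<Suc n. t ! y \<in> A y} =
      measure ?p (A 0) * measure (random_text \<sigma> n) {t. \<forall>y<n. t ! y \<in> A (Suc y)}"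
    unfolding eq measure_map_pmf vim by (rule measure_pmf_prob_product) auto
  also have "\<dots> = measure ?p (A 0) * (\<Prod>y<n. measure ?p (A (Suc y)))"
    by (subst Suc.IH) simp
  also have "\<dots> = (\<Prod>y<Suc n. measure ?p (A y))"
    by (subst prod.lessThan_Suc_shift) simp
  finally show ?case .
qed

text \<open>Positions outside \<open>Y\<close> get the certain event \<open>UNIV\<close> and
  contribute the factor 1.\<close>

lemma measure_random_text_le:
  fixes p :: real
  assumes "Y \<subseteq> {..<n}" and "\<And>y. y \<in> Y \<Longrightarrow> measure (pmf_of_set {..<\<sigma>}) (A y) \<le> p"
  shows "measure (random_text \<sigma> n) {t. \<forall>y\<in>Y. t ! y \<in> A y} \<le> p ^ card Y"
proof -
  define A' where "A' y = (if y \<in> Y then A y else UNIV)" for y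
  have "{t. \<forall>y\<in>Y. t ! y \<in> A y} = {t. \<forall>y<n. t ! y \<in> A' y}"
    using assms(1) by (auto simp: A'_def)
  then have "measure (random_text \<sigma> n) {t. \<forall>y\<in>Y. t ! y \<in> A y} = (\<Prod>y<n. measure (pmf_of_set {..<\<sigma>}) (A' y))"
    by (simp add: measure_random_text)
  also have "\<dots> = (\<Prod>y\<in>Y. measure (pmf_of_set {..<\<sigma>}) (A y))"
    using assms(1) by (intro prod.mono_neutral_cong_right) (auto simp: A'_def)
  also have "\<dots> \<le> (\<Prod>y\<in>Y. p)"
    using assms(2) by (intro prod_mono) auto
  finally show ?thesis by simp
qed

text \<open>Within a residue class a letter is determined by its quotient by
  \<open>s\<close>.\<close>

lemma card_residue_class:
  fixes s :: nat
  shows "card {c. c < \<sigma> \<and> c mod s = r} \<le> \<sigma> div s + 1"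
proof -
  have "inj_on (\<lambda>c. c div s) {c. c < \<sigma> \<and> c mod s = r}"
    by (rule inj_onI) (metis (mono_tags) div_mult_mod_eq mem_Collect_eq)
  then have "card {c. c < \<sigma> \<and> c mod s = r} \<le> card {..\<sigma> div s}"
    by (rule card_inj_on_le) (auto intro: div_le_mono)
  then show ?thesis by simp
qed

text \<open>For \<sigma> at most \<open>m\<close> the residue determines the letter. Otherwise
  \<open>s = m\<close> need not divide \<sigma>, and the uneven classes cost a factor 2 over
  \<open>1 / m\<close>; the square absorbs it, since \<open>(2 / m) ^ 2 \<le> 1 / m\<close> for
  \<open>m \<ge> 4\<close>. This is the origin of the square root in the probability per
  letter.\<close>

lemma measure_residue_class:
  assumes "2 \<le> \<sigma>" "4 \<le> m" and s: "s = min \<sigma> m"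
  shows "(measure (pmf_of_set {..<\<sigma>}) {c. c mod s = r})\<^sup>2 \<le> 1 / real s"
proof -
  have "0 \<in> {..<\<sigma>}" using assms(1) by simp
  then have ne: "{..<\<sigma>} \<noteq> {}" by blast
  have eq: "measure (pmf_of_set {..<\<sigma>}) {c. c mod s = r} = real (card {c. c < \<sigma> \<and> c mod s = r}) / real \<sigma>"
    using ne by (simp add: measure_pmf_of_set Int_def)
  show ?thesis
  proof (cases "\<sigma> \<le> m")
    case True
    then have "s = \<sigma>" using s by simp
    then have "{c. c < \<sigma> \<and> c mod s = r} \<subseteq> {r}" by auto
    then have "card {c. c < \<sigma> \<and> c mod s = r} \<le> 1" using card_mono[of "{r}"] by fastforce
    then have "real (card {c. c < \<sigma> \<and> c mod s = r}) / real \<sigma> \<le> 1 / real \<sigma>"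
      by (intro divide_right_mono) auto
    then have "(real (card {c. c < \<sigma> \<and> c mod s = r}) / real \<sigma>)\<^sup>2 \<le> (1 / real \<sigma>)\<^sup>2"
      by (intro power_mono) auto
    also have "\<dots> \<le> 1 / real \<sigma>" using assms(1) by (simp add: power2_eq_square field_simps)
    finally show ?thesis using eq \<open>s = \<sigma>\<close> by simp
  next
    case False
    then have sm: "s = m" using s by simp
    have "real (\<sigma> div s) \<le> real \<sigma> / real m" unfolding sm by (rule of_nat_div_le_of_nat)
    moreover have "real (card {c. c < \<sigma> \<and> c mod s = r}) \<le> real (\<sigma> div s) + 1"
      using card_residue_class[of \<sigma> s r] by linarith
    moreover have "1 \<le> real \<sigma> / real m" using False assms(2) by (simp add: field_simps)
    ultimately have "real (card {c. c < \<sigma> \<and> c mod s = r}) \<le> 2 * (real \<sigma> / real m)"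
      by linarith
    then have "real (card {c. c < \<sigma> \<and> c mod s = r}) / real \<sigma> \<le> 2 / real m"
      using assms by (simp add: field_simps)
    then have "(real (card {c. c < \<sigma> \<and> c mod s = r}) / real \<sigma>)\<^sup>2 \<le> (2 / real m)\<^sup>2"
      by (intro power_mono) auto
    also have "\<dots> \<le> 1 / real m" using assms(2) by (simp add: power2_eq_square field_simps)
    finally show ?thesis using eq sm by simp
  qed
qed

section \<open>Probability of a naive check and expected cost\<close>

context searching begin

text \<open>For one block and alignment, at least \<open>h\<close> distinct text letters must have
  prescribed residues, which has probability at most \<open>p ^ h\<close>. A union bound over the
  blocks chosen and the alignments that fit does the rest.\<close>

lemma measure_flag:
  assumes cov: "covered bs = {..<m}" and m4: "4 \<le> m" and v: "v < n div m"
  shows "measure (random_text \<sigma> n) {t. is_text \<sigma> t \<and> length t = n \<and> flag t v} \<le> 1 / real m ^ 2"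
proof -
  let ?M = "random_text \<sigma> n"
  define P where "P = {i. i < m \<and> v * m + i + m \<le> n}"
  define A where "A b i = {t. \<forall>k\<in>hits b i. t ! (v * m + (b * Q + k)) mod s = the (x ! (b * Q + k - i)) mod s}" for b i
  define G where "G b = {i \<in> P. good b i}" for b
  have fin: "finite (G b)" for b by (simp add: G_def P_def)
  define p where "p = sqrt (1 / real s)"
  have s1: "1 \<le> s" using s_pos by simp
  have p: "0 \<le> p" "p \<le> 1" "p ^ 2 = 1 / real s" using s1 by (simp_all add: p_def)
  have ph: "p ^ h \<le> 1 / real m ^ 4"
  proof -
    have "p ^ h = (p ^ 2) ^ (4 * q)" by (simp add: h_def power_mult[symmetric])
    also have "\<dots> = 1 / (real s ^ q) ^ 4"
      by (simp add: p(3) power_divide power_mult[symmetric] mult.commute)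
    also have "\<dots> \<le> 1 / real m ^ 4"
    proof (intro divide_left_mono power_mono)
      show "real m \<le> real s ^ q" using m_le_s_pow_q by (metis of_nat_le_iff of_nat_power)
    qed (use s1 m4 in \<open>auto intro!: mult_pos_pos zero_less_power\<close>)
    finally show ?thesis .
  qed
  have A: "measure ?M (A b i) \<le> 1 / real m ^ 4" if i: "i \<in> G b" for b i
  proof -
    define f where "f k = v * m + (b * Q + k)" for k
    have inj: "inj_on f (hits b i)" by (auto simp: inj_on_def f_def)
    define r where "r y = the (x ! (y - v * m - i)) mod s" for y
    have eq: "A b i = {t. \<forall>y\<in>f ` hits b i. t ! y \<in> {c. c mod s = r y}}"
      by (auto simp: A_def f_def r_def)
    have "measure ?M (A b i) \<le> p ^ card (f ` hits b i)"
      unfolding eq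
    proof (rule measure_random_text_le)
      show "f ` hits b i \<subseteq> {..<n}" using i by (auto simp: f_def hits_def G_def P_def)
      fix y
      have "(measure (pmf_of_set {..<\<sigma>}) {c. c mod s = r y})\<^sup>2 \<le> p\<^sup>2"
        unfolding p(3) by (rule measure_residue_class[OF sigma m4]) (simp add: s_def)
      then show "measure (pmf_of_set {..<\<sigma>}) {c. c mod s = r y} \<le> p" using p(1) by (rule power2_le_imp_le)
    qed
    also have "\<dots> \<le> p ^ h"
      using i p unfolding card_image[OF inj] by (intro power_decreasing) (auto simp: G_def good_def)
    finally show ?thesis using ph by linarith
  qed
  have "{t. is_text \<sigma> t \<and> length t = n \<and> flag t v} \<subseteq> (\<Union>b\<in>set bs. \<Union>i\<in>G b. A b i)"
  proof
    fix t assume "t \<in> {t. is_text \<sigma> t \<and> length t = n \<and> flag t v}"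
    then have "\<exists>b\<in>set bs. \<exists>i<m. good b i \<and> v * m + i + m \<le> n \<and>
      (\<forall>k\<in>hits b i. t ! (v * m + (b * Q + k)) mod s = the (x ! (b * Q + k - i)) mod s)"
      using flag_witness[of t v] cov by blast
    then show "t \<in> (\<Union>b\<in>set bs. \<Union>i\<in>G b. A b i)" by (auto simp: A_def G_def P_def)
  qed
  then have "measure ?M {t. is_text \<sigma> t \<and> length t = n \<and> flag t v} \<le> measure ?M (\<Union>b\<in>set bs. \<Union>i\<in>G b. A b i)"
    by (intro measure_pmf.finite_measure_mono) auto
  also have "\<dots> \<le> (\<Sum>b\<in>set bs. measure ?M (\<Union>i\<in>G b. A b i))"
    by (intro measure_pmf.finite_measure_subadditive_finite) auto
  also have "\<dots> \<le> (\<Sum>b\<in>set bs. \<Sum>i\<in>G b. measure ?M (A b i))"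
    by (intro sum_mono measure_pmf.finite_measure_subadditive_finite fin) auto
  also have "\<dots> \<le> (\<Sum>b\<in>set bs. \<Sum>i\<in>G b. 1 / real m ^ 4)"
    by (intro sum_mono A) auto
  also have "\<dots> \<le> (\<Sum>b\<in>set bs. real m * (1 / real m ^ 4))"
  proof (rule sum_mono)
    fix b
    have "card (G b) \<le> card {..<m}" by (rule card_mono) (auto simp: G_def P_def)
    then show "(\<Sum>i\<in>G b. 1 / real m ^ 4) \<le> real m * (1 / real m ^ 4)"
      by (simp add: divide_right_mono)
  qed
  also have "\<dots> = real (card (set bs)) * (real m * (1 / real m ^ 4))" by simp
  also have "\<dots> \<le> real m * (real m * (1 / real m ^ 4))"
  proof (rule mult_right_mono)
    have "card (set bs) \<le> m" using card_length[of bs] chosen by (simp add: chosen_def)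
    then show "real (card (set bs)) \<le> real m" by simp
  qed simp
  also have "\<dots> = 1 / real m ^ 2" using m4 by (simp add: field_simps power2_eq_square power4_eq_xxxx)
  finally show ?thesis .
qed

lemma set_random_text: "set_pmf (random_text \<sigma> n) = {t. is_text \<sigma> t \<and> length t = n}"
proof -
  have "0 \<in> {..<\<sigma>}" using sigma by simp
  then have "{..<\<sigma>} \<noteq> {}" by blast
  then show ?thesis by (auto simp: random_text_def set_replicate_pmf is_text_def lists_eq_set)
qed

lemma expectation_search:
  assumes cov: "covered bs = {..<m}" and m4: "4 \<le> m"
    and T: "\<And>t. is_text \<sigma> t \<Longrightarrow> length t = n \<Longrightarrow> T t \<le> (\<Sum>v<n div m. window_cost t v) + 40"
  shows "measure_pmf.expectation (random_text \<sigma> n) (\<lambda>t. real (T t)) \<le>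
    real n / real m * (real (length bs) * (40 * real Q + 140) + 320)"
proof -
  let ?M = "random_text \<sigma> n"
  define F where "F v = {t. is_text \<sigma> t \<and> length t = n \<and> flag t v}" for v
  define a where "a = real (length bs) * (40 * real Q + 140) + 100"
  define c where "c = real m * (40 * real m + 100) + 40"
  have fin: "finite (set_pmf ?M)"
  proof -
    have "set_pmf ?M \<subseteq> {t. set t \<subseteq> {..<\<sigma>} \<and> length t = n}" unfolding set_random_text by (auto simp: is_text_def)
    then show ?thesis by (rule finite_subset) (rule finite_lists_length_eq, simp)
  qed
  have "measure_pmf.expectation ?M (\<lambda>t. real (T t)) \<le>
      measure_pmf.expectation ?M (\<lambda>t. (\<Sum>v<n div m. a + c * indicator (F v) t) + 40)"
  proof (rule integral_mono_AE)
    show "AE t in ?M. real (T t) \<le> (\<Sum>v<n div m. a + c * indicator (F v) t) + 40"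
    proof (rule AE_pmfI)
      fix t assume "t \<in> set_pmf ?M"
      then have t: "is_text \<sigma> t" "length t = n" by (auto simp: set_random_text)
      have "real (window_cost t v) = a + c * indicator (F v) t" for v
        using t by (simp add: window_cost_def[OF t] a_def c_def F_def)
      moreover have "real (T t) \<le> real ((\<Sum>v<n div m. window_cost t v) + 40)" using T[OF t] by (simp only: of_nat_le_iff)
      ultimately show "real (T t) \<le> (\<Sum>v<n div m. a + c * indicator (F v) t) + 40" by simp
    qed
  qed (use fin in \<open>auto intro: integrable_measure_pmf_finite\<close>)
  also have "\<dots> = (\<Sum>v<n div m. a + c * measure ?M (F v)) + 40"
    using fin by (subst Bochner_Integration.integral_add)
      (auto intro!: integrable_measure_pmf_finite simp: Bochner_Integration.integral_sum Bochner_Integration.integral_add integrable_measure_pmf_finite)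
  also have "\<dots> \<le> (\<Sum>v<n div m. a + c * (1 / real m ^ 2)) + 40"
  proof (intro add_right_mono sum_mono add_left_mono mult_left_mono)
    fix v assume "v \<in> {..<n div m}"
    then show "measure ?M (F v) \<le> 1 / real m ^ 2" unfolding F_def using measure_flag[OF cov m4] by simp
  qed (simp add: c_def)
  also have "\<dots> \<le> real (n div m) * (a + 180) + 40"
  proof -
    \<comment> \<open>For \<open>m \<ge> 4\<close> the linear and constant terms of the naive cost
      are dominated by \<open>m ^ 2\<close>; 180 is the generous sum of the coefficients.\<close>
    have "c \<le> 180 * real m ^ 2"
    proof -
      have "4 * real m \<le> real m * real m" using m4 by (intro mult_right_mono) auto
      moreover have "4 * 4 \<le> real m * real m" using m4 by (intro mult_mono) auto
      ultimately show ?thesis by (simp add: c_def power2_eq_square algebra_simps)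
    qed
    moreover have "0 < real m ^ 2" using m4 by (intro zero_less_power) linarith
    ultimately have "c * (1 / real m ^ 2) \<le> 180" by (simp add: divide_le_eq)
    then have "real (n div m) * (a + c * (1 / real m ^ 2)) \<le> real (n div m) * (a + 180)"
      by (intro mult_left_mono) auto
    then show ?thesis by simp
  qed
  also have "\<dots> \<le> real n / real m * (a + 180) + real n / real m * 40"
  proof (rule add_mono)
    show "real (n div m) * (a + 180) \<le> real n / real m * (a + 180)"
      by (intro mult_right_mono of_nat_div_le_of_nat) (simp add: a_def)
    \<comment> \<open>The additive constant is charged to the windows, as
      \<open>n / m > 1\<close>.\<close>
    show "40 \<le> real n / real m * 40" using m_less nonempty by (simp add: field_simps)
  qed
  also have "\<dots> = real n / real m * (real (length bs) * (40 * real Q + 140) + 320)"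
    by (simp add: a_def algebra_simps)
  finally show ?thesis .
qed

end

section \<open>Choice of the constants and the final estimate\<close>

lemma eventually_window_large:
  fixes E :: nat
  shows "\<exists>m0. \<forall>m\<ge>m0. 64 * real E * (1 + log 2 (real m)) \<le> real m"
proof -
  have "eventually (\<lambda>m::nat. 64 * real E * (1 + log 2 (real m)) \<le> real m) sequentially"
    by real_asymp
  then show ?thesis by (simp add: eventually_sequentially)
qed

theorem theorem12:
  fixes \<epsilon> :: real
  assumes "0 < \<epsilon>" and "\<epsilon> < 1"
  shows "\<exists>(prep :: com) (srch :: com) (\<kappa> :: real) (C :: real) (m0 :: nat). \<kappa> > 0 \<and> C > 0 \<and>
    (\<forall>(\<sigma> :: nat) (x :: nat option list) (m :: nat) (g :: nat) (n :: nat) (w :: nat).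
       2 \<le> \<sigma> \<and> is_pattern \<sigma> x \<and> length x = m \<and> wildcards x = g \<and> g < m \<and> m < n \<and>
       real w \<ge> \<kappa> * log 2 (real n) \<and> \<sigma> < 2 ^ w \<longrightarrow>
       (\<exists>T. finds_occurrences prep srch w \<sigma> x n T \<and>
          (m0 \<le> m \<and>
           (\<forall>j \<le> nat \<lceil>3 * log 2 (real m)\<rceil>. 0 < F x j) \<and>
           real g + (\<Sum>j \<le> nat \<lceil>3 * log 2 (real m)\<rceil>. log 2 (real m) / F x j) < \<epsilon> * real m \<longrightarrow>
           measure_pmf.expectation (random_text \<sigma> n) (\<lambda>t. real (T t))
             \<le> C * (real n * log_factor \<sigma> m * log 2 (real m) / real m))))"
proof -
  \<comment> \<open>An integer bound on the inverse of the guaranteed density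
    \<open>1 - \<epsilon>\<close> of non-wildcards.\<close>
  define E where "E = nat \<lceil>1 / (1 - \<epsilon>)\<rceil>"
  have E: "1 / (1 - \<epsilon>) \<le> real E" unfolding E_def by (rule real_nat_ceiling_ge)
  have E1: "1 \<le> (1 - \<epsilon>) * real E" using E assms by (simp add: field_simps)
  have "0 < 1 / (1 - \<epsilon>)" using assms by simp
  then have E0: "0 < E" using E by (cases E) auto
  define R where "R = 8 * E"
  obtain m1 where m1: "\<And>m. m \<ge> m1 \<Longrightarrow> 64 * real E * (1 + log 2 (real m)) \<le> real m"
    using eventually_window_large[of E] by blast
  define m0 where "m0 = max 4 m1"
  define K where "K = 6 * E"
  \<comment> \<open>At most \<open>(1 + K) * log 2 m\<close> blocks, each costing
    \<open>40 * Q + 140\<close> with \<open>Q \<le> 128 * E * log_factor \<sigma> m\<close>, and 40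
    times 128 is 5120. The 320 collects 100 per window, 180 for the expected naive checks and 40 for
    the start.\<close>
  define C where "C = (1 + real K) * (5120 * real E + 140) + 320"
  \<comment> \<open>Turns the assumption on the word size into
    \<open>n ^ (49 * R + 28) \<le> 2 ^ w\<close>, as \<open>fits_bounds\<close> demands.\<close>
  define \<kappa> where "\<kappa> = real (49 * R + 28)"
  show ?thesis
  proof (rule exI[of _ "preprocess R"], rule exI[of _ search], rule exI[of _ \<kappa>], rule exI[of _ C],
      rule exI[of _ m0], intro conjI allI impI)
    show "\<kappa> > 0" by (simp add: \<kappa>_def)
    show "C > 0" by (simp add: C_def add_nonneg_pos)
    fix \<sigma> x m g n w
    assume a: "2 \<le> \<sigma> \<and> is_pattern \<sigma> x \<and> length x = m \<and> wildcards x = g \<and> g < m \<and> m < n \<and>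
       real w \<ge> \<kappa> * log 2 (real n) \<and> \<sigma> < 2 ^ w"
    then have len: "length x = m" and wild: "wildcards x = g" and gm: "g < m" and mn: "m < n" by auto
    interpret probing x \<sigma> R by standard (use a in auto)
    have n_pow: "n ^ (49 * R + 28) \<le> 2 ^ w"
    proof -
      have "real n ^ (49 * R + 28) = 2 powr (\<kappa> * log 2 (real n))"
        using mn by (simp add: \<kappa>_def powr_powr[symmetric] mult.commute[of _ "log 2 (real n)"] powr_realpow[symmetric] del: of_nat_add of_nat_mult)
      also have "\<dots> \<le> 2 powr real w" using a by (intro powr_mono) auto
      also have "\<dots> = 2 ^ w" by (simp add: powr_realpow)
      finally show ?thesis by (metis (mono_tags) of_nat_le_iff of_nat_numeral of_nat_power)
    qed
    have mn': "length x < n" using len mn by simp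
    note fb = fits_bounds[OF mn' n_pow]
    interpret preprocessing x \<sigma> R w by standard (use a fb in auto)
    obtain k s0 bs where prep: "exec I (preprocess R) init_state k s0"
      and s0: "params s0" "greedy_seq bs" "chosen bs s0" "tabulated B 0 s0"
        "covered bs = {..<length x} \<or> length bs = length x"
      using wp_preprocess unfolding wp_def by blast
    interpret searching x \<sigma> R w s0 bs n by standard (use s0 fb mn' in auto)
    have "\<exists>k s1. exec (J t) search (s0\<lparr>out := []\<rparr>) k s1 \<and> set (out s1) = occurrences x t \<and>
        k \<le> (\<Sum>v<n div length x. window_cost t v) + 40" if "is_text \<sigma> t" "length t = n" for t
      using wp_search[OF that] unfolding wp_def by blast
    then obtain T where T: "\<And>t. is_text \<sigma> t \<Longrightarrow> length t = n \<Longrightarrow>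
        (\<exists>s1. exec (J t) search (s0\<lparr>out := []\<rparr>) (T t) s1 \<and> set (out s1) = occurrences x t) \<and>
        T t \<le> (\<Sum>v<n div length x. window_cost t v) + 40"
      by metis
    show "\<exists>T. finds_occurrences (preprocess R) search w \<sigma> x n T \<and>
          (m0 \<le> m \<and>
           (\<forall>j \<le> nat \<lceil>3 * log 2 (real m)\<rceil>. 0 < F x j) \<and>
           real g + (\<Sum>j \<le> nat \<lceil>3 * log 2 (real m)\<rceil>. log 2 (real m) / F x j) < \<epsilon> * real m \<longrightarrow>
           measure_pmf.expectation (random_text \<sigma> n) (\<lambda>t. real (T t))
             \<le> C * (real n * log_factor \<sigma> m * log 2 (real m) / real m))"
    proof (intro exI[of _ T] conjI impI)
      show "finds_occurrences (preprocess R) search w \<sigma> x n T"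
        unfolding finds_occurrences_def using prep T by blast
      assume h: "m0 \<le> m \<and>
           (\<forall>j \<le> nat \<lceil>3 * log 2 (real m)\<rceil>. 0 < F x j) \<and>
           real g + (\<Sum>j \<le> nat \<lceil>3 * log 2 (real m)\<rceil>. log 2 (real m) / F x j) < \<epsilon> * real m"
      then have m4: "4 \<le> m" and "m1 \<le> m" by (auto simp: m0_def)
      define L where "L = log 2 (real m)"
      have L1: "1 \<le> L" using m4 by (simp add: L_def le_log_iff)
      \<comment> \<open>Positivity of all the values of \<open>F\<close> makes the sum nonnegative,
        so that the hypothesis bounds the number of wildcards by
        \<open>\<epsilon> * m\<close>.\<close>
      have "0 \<le> (\<Sum>j \<le> nat \<lceil>3 * log 2 (real m)\<rceil>. log 2 (real m) / F x j)"
        using h L1 unfolding L_def by (intro sum_nonneg divide_nonneg_pos) auto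
      then have g: "real g < \<epsilon> * real m" using h by linarith
      have "real m \<le> real m * ((1 - \<epsilon>) * real E)" using E1 by (simp add: mult_le_cancel_left1)
      also have "\<dots> = (real m - \<epsilon> * real m) * real E" by (simp add: algebra_simps)
      also have "\<dots> \<le> real (card solid) * real E"
      proof (rule mult_right_mono)
        have "real (card solid) + real g = real m" using card_solid wild len by (metis of_nat_add)
        then show "real m - \<epsilon> * real m \<le> real (card solid)" using g by linarith
      qed simp
      finally have solid: "length x \<le> card solid * E" unfolding len by (metis of_nat_le_iff of_nat_mult)
      have m2: "2 \<le> length x" using m4 len by simp
      have "Q = R * (8 * q)" by (simp only: Q_def h_def)
      also have "R * (8 * q) = 64 * E * q" by (simp add: R_def)
      finally have Qq: "Q = 64 * E * q" .
      have Q0: "0 < Q" using q_pos[OF m2] E0 by (simp add: Qq)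
      have "real Q \<le> 64 * real E * (1 + L)"
        using q_le_log2[OF m2] unfolding Qq len L_def by (simp add: mult_left_mono)
      also have "\<dots> \<le> real m" unfolding L_def by (rule m1[OF \<open>m1 \<le> m\<close>])
      finally have Qm: "Q \<le> length x" by (simp add: len)
      have K: "\<exists>b<B. card ({..<length x} - C) \<le> K * gain C b" for C
        by (rule gain_ge) (unfold K_def, rule good_fraction[OF R_def solid Q0 Qm])
      have K0: "0 < K" using E0 by (simp add: K_def)
      note cov = greedy_covers[OF K K0 s0(2,5)]
      have "ln (real m) = L * ln 2" using m4 by (simp add: L_def log_def)
      also have "\<dots> \<le> L * 1" using L1 ln_2_less_1 by (intro mult_left_mono) auto
      finally have "real K * ln (real m) \<le> real K * L" by (simp add: mult_left_mono)
      then have lb: "real (length bs) \<le> (1 + real K) * L"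
        using greedy_length[OF K K0 s0(2)] L1 unfolding len by (simp add: algebra_simps)
      define l where "l = log_factor \<sigma> m"
      have l1: "1 \<le> l" by (simp add: l_def log_factor_def)
      have "real q \<le> 2 * l" using q_le_log_factor[OF m2] by (simp add: l_def len)
      then have "(64 * real E) * real q \<le> (64 * real E) * (2 * l)" by (intro mult_left_mono) auto
      then have "real Q \<le> 64 * real E * (2 * l)" by (simp add: Qq)
      then have Q140: "40 * real Q + 140 \<le> (5120 * real E + 140) * l" using l1 by (simp add: algebra_simps)
      have "real (length bs) * (40 * real Q + 140) \<le> ((1 + real K) * L) * ((5120 * real E + 140) * l)"
        using lb Q140 L1 by (intro mult_mono) auto
      moreover have "320 * 1 \<le> 320 * (L * l)" using L1 l1 mult_mono[of 1 L 1 l] by (intro mult_left_mono) auto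
      ultimately have bound: "real (length bs) * (40 * real Q + 140) + 320 \<le> C * (L * l)"
        by (simp add: C_def algebra_simps)
      have "measure_pmf.expectation (random_text \<sigma> n) (\<lambda>t. real (T t)) \<le>
          real n / real m * (real (length bs) * (40 * real Q + 140) + 320)"
        using expectation_search[OF cov, of T] T m4 unfolding len by blast
      also have "\<dots> \<le> real n / real m * (C * (L * l))" by (intro mult_left_mono bound) auto
      also have "\<dots> = C * (real n * log_factor \<sigma> m * log 2 (real m) / real m)"
        by (simp add: L_def l_def)
      finally show "measure_pmf.expectation (random_text \<sigma> n) (\<lambda>t. real (T t))
          \<le> C * (real n * log_factor \<sigma> m * log 2 (real m) / real m)" .
    qed
  qed
qed

end
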